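(* Let $H$ be a fixed strictly balanced graph with $v_H\ge 4$ and minimum degree $\delta_H\ge 2$, and let $\lambda=(e_H-2)/(v_H-2)$. Then $$p_c(n,H)\le O(n^{-1/\lambda}),$$ i.e. there is a constant $C$ (depending only on $H$) such that $p_c(n,H)\le C n^{-1/\lambda}$ for all sufficiently large $n$.
   Context: All graphs are finite and simple. $v_F$ and $e_F$ denote the numbers of vertices and edges of a graph $F$; $F\subset H$ means $F$ is a (not necessarily induced) subgraph of $H$. $H$-percolation: for graphs $G$ and $H$, set $G_0=G$ and, for $t\ge 1$, let $G_t$ (on the same vertex set as $G$) be obtained from $G_{t-1}$ by adding every edge not in $G_{t-1}$ which, if added to $G_{t-1}$, creates a new copy of $H$. Let $\langle G\rangle_H=\bigcup_t G_t$. $\mathcal G_{n,p}$ is the Erdős–Rényi random graph on $n$ labelled vertices, each edge of $K_n$ being present independently with probability $p$. The critical threshold is $$p_c(n,H)=\inf\{p>0:\ \mathbb P(\langle \mathcal G_{n,p}\rangle_H=K_n)\ge 1/2\}.$$ A graph $H$ is strictly balanced if $v_H\ge 4$ and $(e_F-1)/(v_F-2)< \lambda$ for all subgraphs $F\subset H$ with $3\le v_F<v_H$, where $\lambda=(e_H-2)/(v_H-2)$. *)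

theory Defs
  imports "HOL-Probability.Probability"
begin

section \<open>Finite simple graphs\<close>

record 'a sgraph =
  verts :: "'a set"
  edges :: "'a set set"

definition pairs_of :: "'a set \<Rightarrow> 'a set set" where
  "pairs_of V = {e. e \<subseteq> V \<and> card e = 2}"

definition finite_simple_graph :: "'a sgraph \<Rightarrow> bool" where
  "finite_simple_graph G \<longleftrightarrow> finite (verts G) \<and> edges G \<subseteq> pairs_of (verts G)"

definition num_verts :: "'a sgraph \<Rightarrow> nat" where
  "num_verts G = card (verts G)"

definition num_edges :: "'a sgraph \<Rightarrow> nat" where
  "num_edges G = card (edges G)"

definition degree :: "'a sgraph \<Rightarrow> 'a \<Rightarrow> nat" where
  "degree G v = card {e \<in> edges G. v \<in> e}"

definition min_degree :: "'a sgraph \<Rightarrow> nat" where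
  "min_degree G = Min (degree G ` verts G)"

definition subgraph :: "'a sgraph \<Rightarrow> 'a sgraph \<Rightarrow> bool" where
  "subgraph F G \<longleftrightarrow>
     finite_simple_graph F \<and> verts F \<subseteq> verts G \<and> edges F \<subseteq> edges G"

definition isomorphic :: "'a sgraph \<Rightarrow> 'b sgraph \<Rightarrow> bool" where
  "isomorphic F H \<longleftrightarrow>
     (\<exists>f. bij_betw f (verts F) (verts H) \<and> edges H = (\<lambda>e. f ` e) ` edges F)"

definition is_copy :: "'b sgraph \<Rightarrow> 'a sgraph \<Rightarrow> 'a sgraph \<Rightarrow> bool" where
  "is_copy H G F \<longleftrightarrow> subgraph F G \<and> isomorphic F H"

section \<open>\<open>H\<close>-percolation\<close>

definition add_edge :: "'a set \<Rightarrow> 'a sgraph \<Rightarrow> 'a sgraph" where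
  "add_edge e G = \<lparr>verts = verts G, edges = insert e (edges G)\<rparr>"

definition creates_new_copy :: "'b sgraph \<Rightarrow> 'a sgraph \<Rightarrow> 'a set \<Rightarrow> bool" where
  "creates_new_copy H G e \<longleftrightarrow> (\<exists>F. is_copy H (add_edge e G) F \<and> \<not> is_copy H G F)"

definition perc_step :: "'b sgraph \<Rightarrow> 'a sgraph \<Rightarrow> 'a sgraph" where
  "perc_step H G = \<lparr>verts = verts G,
     edges = edges G \<union> {e \<in> pairs_of (verts G). e \<notin> edges G \<and> creates_new_copy H G e}\<rparr>"

definition perc_closure :: "'b sgraph \<Rightarrow> 'a sgraph \<Rightarrow> 'a sgraph" where
  "perc_closure H G = \<lparr>verts = verts G, edges = (\<Union>t. edges ((perc_step H ^^ t) G))\<rparr>"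

section \<open>Random graphs and the critical threshold\<close>

definition complete_graph :: "nat \<Rightarrow> nat sgraph" where
  "complete_graph n = \<lparr>verts = {1..n}, edges = pairs_of {1..n}\<rparr>"

definition gnp :: "nat \<Rightarrow> real \<Rightarrow> nat sgraph pmf" where
  "gnp n p = map_pmf (\<lambda>X. \<lparr>verts = {1..n}, edges = {e \<in> pairs_of {1..n}. X e}\<rparr>)
     (Pi_pmf (pairs_of {1..n}) False (\<lambda>_. bernoulli_pmf p))"

text \<open>
  The bound \<open>p \<le> 1\<close> keeps \<open>p\<close> a probability; \<open>p = 1\<close> always belongs to the set, so
  the infimum is over a nonempty set that is bounded below.
\<close>

definition crit_threshold :: "nat \<Rightarrow> 'b sgraph \<Rightarrow> real" where
  "crit_threshold n H = Inf {p. 0 < p \<and> p \<le> 1 \<and>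
     measure_pmf.prob (gnp n p) {G. perc_closure H G = complete_graph n} \<ge> 1 / 2}"

section \<open>Strictly balanced graphs\<close>

definition lam :: "'a sgraph \<Rightarrow> real" where
  "lam H = (real (num_edges H) - 2) / (real (num_verts H) - 2)"

definition strictly_balanced :: "'a sgraph \<Rightarrow> bool" where
  "strictly_balanced H \<longleftrightarrow> num_verts H \<ge> 4 \<and>
     (\<forall>F. subgraph F H \<and> 3 \<le> num_verts F \<and> num_verts F < num_verts H \<longrightarrow>
        (real (num_edges F) - 1) / (real (num_verts F) - 2) < lam H)"

end

theory Submission
  imports Defs "HOL-Real_Asymp.Real_Asymp"
begin

text \<open>
Write \<open>v\<close> and \<open>e\<close> for the numbers of vertices and edges of \<open>H\<close> and put \<open>p = C n^(-1/\<lambda>)\<close>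
with a large constant \<open>C\<close>. The proof has three parts.

A fixed pair \<open>xy\<close> is infected with probability close to 1. Choose two disjoint edges \<open>ab\<close> and \<open>cd\<close>
of \<open>H\<close>. A copy of \<open>H - ab - cd\<close> placed so that \<open>ab\<close> falls on \<open>xy\<close> reduces the infection of \<open>xy\<close> to
that of the pair on which \<open>cd\<close> falls. Chaining \<open>L\<close> such rungs on fresh vertices, and ending with an edge
that is present, gives a ladder with \<open>L(v-2)+2\<close> vertices and \<open>L(e-2)+1\<close> edges. The expected number of
ladders in the random graph is about \<open>p \<nu>^L\<close> with \<open>\<nu> = n^(v-2) p^(e-2) = C^(e-2)\<close>, which is
huge as soon as \<open>L\<close> is about \<open>ln n\<close>. The second moment is controlled by fixing one ladder with vertex set
\<open>W\<close> and building the second one rung by rung. Relative to a rung on new vertices, a rung that meets \<open>W\<close>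
weighs less by a power of \<open>n\<close>, by strict balancedness, unless all of it lies in the first ladder. Then both
vertices of its base pair lie in \<open>W\<close>, bounded degrees leave only a bounded number \<open>K\<close> of choices, and the
relative weight is \<open>K/\<nu>\<close>, which is small for large \<open>C\<close>. The second ladder therefore either leaves the first
one after a few rungs, which contributes \<open>1 + O(K/\<nu>)\<close>, or returns to it later. Returning carries a factor \<open>1/n\<close> up to
logarithms, which outweighs the factor \<open>1/p\<close> gained by sharing the last edge because \<open>\<lambda> > 1\<close>. See
\<open>overlap_sum_bound\<close>, \<open>prob_infected_ge\<close> and \<open>eventually_prob_infected\<close>.

Almost all pairs suffice for a large clique. By Markov's inequality all but a small fraction of the pairs are
infected with probability at least \<open>3/4\<close>. Discarding the vertices that miss many pairs leaves a linear-sized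
set in which any two vertices have many common neighbours, so a copy of \<open>H\<close> minus an edge can be chosen
greedily around every pair: the set becomes an infected clique (\<open>infected_clique_of_few_missing\<close>).

A second independent round of edges of the same density joins every remaining vertex to at least \<open>v\<close>
vertices of the clique, since \<open>n p\<close> is a positive power of \<open>n\<close>; then everything becomes infected
(\<open>prob_many_neighbours\<close>, \<open>infected_all_of_clique\<close>).
\<close>

section \<open>Percolation as an inductive closure\<close>

text \<open>
The same pairs as in the limit of the percolation process, but generated without reference to time. In this
form the closure is visibly monotone in the seed set, and a pair is shown to be infected by exhibiting one
copy of \<open>H\<close> through it whose other edges are infected.
\<close>

inductive_set infected :: "'b sgraph \<Rightarrow> nat \<Rightarrow> nat set set \<Rightarrow> nat set set"
  for H n X where
  seed: "e \<in> X \<Longrightarrow> e \<in> infected H n X"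
| spread: "\<lbrakk>inj_on \<psi> (verts H); \<psi> ` verts H \<subseteq> {1..n}; f \<in> edges H;
    \<And>g. g \<in> edges H \<Longrightarrow> g \<noteq> f \<Longrightarrow> \<psi> ` g \<in> infected H n X\<rbrakk> \<Longrightarrow> \<psi> ` f \<in> infected H n X"

lemma infected_mono:
  assumes "X \<subseteq> Y"
  shows "infected H n X \<subseteq> infected H n Y"
proof
  fix e assume "e \<in> infected H n X"
  then show "e \<in> infected H n Y"
  proof induction
    case (seed e)
    with assms show ?case by (blast intro: infected.seed)
  next
    case (spread \<psi> f)
    show ?case by (rule infected.spread) (use spread in auto)
  qed
qed

lemma finite_pairs_of: "finite V \<Longrightarrow> finite (pairs_of V)"
  unfolding pairs_of_def by (rule finite_subset[of _ "Pow V"]) auto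

lemma pairs_of_image:
  assumes "inj_on \<psi> V" "e \<in> pairs_of V" "\<psi> ` V \<subseteq> W"
  shows "\<psi> ` e \<in> pairs_of W"
  using assms unfolding pairs_of_def
  by (auto simp: card_image inj_on_subset)

lemma doubleton_in_pairs_of: "{x, y} \<in> pairs_of V \<longleftrightarrow> x \<in> V \<and> y \<in> V \<and> x \<noteq> y"
  unfolding pairs_of_def by (auto simp: card_2_iff doubleton_eq_iff)

lemma verts_perc_iter: "verts ((perc_step H ^^ t) G) = verts G"
  by (induction t) (auto simp: perc_step_def)

lemma edges_perc_iter_mono: "s \<le> t \<Longrightarrow> edges ((perc_step H ^^ s) G) \<subseteq> edges ((perc_step H ^^ t) G)"
  by (induction rule: dec_induct) (auto simp: perc_step_def)

lemma edges_perc_iter_pairs: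
  "edges G \<subseteq> pairs_of (verts G) \<Longrightarrow> edges ((perc_step H ^^ t) G) \<subseteq> pairs_of (verts G)"
  by (induction t) (auto simp: perc_step_def verts_perc_iter)

lemma finite_subset_Union_chain:
  fixes S :: "nat \<Rightarrow> 'a set"
  assumes "finite A" "A \<subseteq> (\<Union>t. S t)" "\<And>s t. s \<le> t \<Longrightarrow> S s \<subseteq> S t"
  shows "\<exists>t. A \<subseteq> S t"
  using assms(1,2)
proof (induction A)
  case (insert x A)
  then obtain t s where "A \<subseteq> S t" "x \<in> S s" by auto
  then show ?case
    using assms(3)[of t "max s t"] assms(3)[of s "max s t"] by (intro exI[of _ "max s t"]) auto
qed auto

text \<open>
A copy of \<open>H\<close> has finitely many edges, so if all of them except \<open>f\<close> are infected eventually, they are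
infected by a common time. At that time adding \<open>f\<close> completes this copy, which did not exist before
because \<open>f\<close> was missing.
\<close>

lemma infected_subset_perc_closure:
  assumes H: "finite_simple_graph H"
  shows "infected H n X \<subseteq> edges (perc_closure H \<lparr>verts = {1..n}, edges = X\<rparr>)"
proof
  let ?G = "\<lparr>verts = {1..n}, edges = X\<rparr> :: nat sgraph"
  define Gt where "Gt t = (perc_step H ^^ t) ?G" for t
  have vGt: "verts (Gt t) = {1..n}" for t by (simp add: Gt_def verts_perc_iter)
  have mono: "s \<le> t \<Longrightarrow> edges (Gt s) \<subseteq> edges (Gt t)" for s t
    unfolding Gt_def by (rule edges_perc_iter_mono)
  have Hp: "edges H \<subseteq> pairs_of (verts H)" and fH: "finite (verts H)"
    using H by (auto simp: finite_simple_graph_def)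
  have fE: "finite (edges H)" using Hp fH finite_pairs_of finite_subset by blast
  fix e assume "e \<in> infected H n X"
  then have "e \<in> (\<Union>t. edges (Gt t))"
  proof induction
    case (seed e)
    then have "e \<in> edges (Gt 0)" by (simp add: Gt_def)
    then show ?case by blast
  next
    case (spread \<psi> f)
    have "(\<lambda>g. \<psi> ` g) ` (edges H - {f}) \<subseteq> (\<Union>t. edges (Gt t))"
      using spread.IH by blast
    then obtain t where t: "(\<lambda>g. \<psi> ` g) ` (edges H - {f}) \<subseteq> edges (Gt t)"
      using finite_subset_Union_chain[of "(\<lambda>g. \<psi> ` g) ` (edges H - {f})" "\<lambda>t. edges (Gt t)"] fE mono
      by auto
    show ?case
    proof (cases "\<psi> ` f \<in> edges (Gt t)")
      case False
      have pf: "\<psi> ` g \<in> pairs_of {1..n}" if "g \<in> edges H" for g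
        using pairs_of_image[OF spread.hyps(1) _ spread.hyps(2)] Hp that by auto
      define F where "F = \<lparr>verts = \<psi> ` verts H, edges = (\<lambda>g. \<psi> ` g) ` edges H\<rparr>"
      have inv_edge: "inv_into (verts H) \<psi> ` \<psi> ` g = g" if "g \<in> edges H" for g
        using that Hp spread.hyps(1) by (intro inv_into_image_cancel) (auto simp: pairs_of_def)
      have iso: "isomorphic F H"
        unfolding isomorphic_def F_def
      proof (intro exI[of _ "inv_into (verts H) \<psi>"] conjI)
        show "bij_betw (inv_into (verts H) \<psi>) (verts \<lparr>verts = \<psi> ` verts H, edges = (`) \<psi> ` edges H\<rparr>) (verts H)"
          using spread.hyps(1) by (simp add: bij_betw_inv_into inj_on_imp_bij_betw)
        show "edges H = (`) (inv_into (verts H) \<psi>) ` edges \<lparr>verts = \<psi> ` verts H, edges = (`) \<psi> ` edges H\<rparr>"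
          using inv_edge by (auto simp: image_image)
      qed
      have sgF: "finite_simple_graph F"
        using fH pairs_of_image[OF spread.hyps(1)] Hp
        by (auto simp: finite_simple_graph_def F_def)
      have "is_copy H (add_edge (\<psi> ` f) (Gt t)) F"
        using iso sgF t spread.hyps(2) vGt
        by (auto simp: is_copy_def subgraph_def add_edge_def F_def)
      moreover have "\<not> is_copy H (Gt t) F"
        using False spread.hyps(3) by (auto simp: is_copy_def subgraph_def F_def)
      ultimately have "creates_new_copy H (Gt t) (\<psi> ` f)"
        by (auto simp: creates_new_copy_def)
      then have "\<psi> ` f \<in> edges (perc_step H (Gt t))"
        using False pf[OF spread.hyps(3)] vGt by (simp add: perc_step_def)
      then have "\<psi> ` f \<in> edges (Gt (Suc t))" by (simp add: Gt_def)
      then show ?thesis by blast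
    qed blast
  qed
  then show "e \<in> edges (perc_closure H ?G)"
    by (simp add: perc_closure_def Gt_def)
qed

lemma perc_closure_eq_complete_graph:
  assumes "finite_simple_graph H" "X \<subseteq> pairs_of {1..n}" "pairs_of {1..n} \<subseteq> infected H n X"
  shows "perc_closure H \<lparr>verts = {1..n}, edges = X\<rparr> = complete_graph n"
proof -
  have "edges (perc_closure H \<lparr>verts = {1..n}, edges = X\<rparr>) \<subseteq> pairs_of {1..n}"
    using edges_perc_iter_pairs[of "\<lparr>verts = {1..n}, edges = X\<rparr>"] assms(2)
    by (auto simp: perc_closure_def)
  then show ?thesis
    using infected_subset_perc_closure[OF assms(1), of n X] assms(3)
    by (auto simp: perc_closure_def complete_graph_def)
qed

section \<open>Second moments, Markov's inequality and sprinkling\<close>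

text \<open>
Chebyshev's inequality for the number of events that occur: on the complement of the union this number
is 0, so it differs from its mean by the whole mean.
\<close>

lemma second_moment_method:
  fixes M :: "'a pmf" and Ev :: "'i \<Rightarrow> 'a set"
  assumes I: "finite I"
    and mu: "\<mu> = (\<Sum>i\<in>I. measure_pmf.prob M (Ev i))" "\<mu> > 0"
    and pairs: "(\<Sum>i\<in>I. \<Sum>j\<in>I. measure_pmf.prob M (Ev i \<inter> Ev j)) \<le> (1 + \<epsilon>) * \<mu>\<^sup>2"
  shows "measure_pmf.prob M (\<Union>i\<in>I. Ev i) \<ge> 1 - \<epsilon>"
proof -
  define X :: "'a \<Rightarrow> real" where "X \<omega> = (\<Sum>i\<in>I. indicator (Ev i) \<omega>)" for \<omega>
  have int: "integrable (measure_pmf M) (indicator A :: 'a \<Rightarrow> real)" for A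
    by (rule measure_pmf.integrable_const_bound[where B = 1]) (auto simp: indicator_def)
  have X2: "(X \<omega>)\<^sup>2 = (\<Sum>i\<in>I. \<Sum>j\<in>I. indicator (Ev i \<inter> Ev j) \<omega>)" for \<omega>
    unfolding X_def power2_eq_square sum_product by (simp add: indicator_inter_arith)
  have EX: "measure_pmf.expectation M X = \<mu>"
    unfolding X_def mu(1) by (subst Bochner_Integration.integral_sum) (auto intro: int)
  have iX2: "integrable (measure_pmf M) (\<lambda>\<omega>. (X \<omega>)\<^sup>2)"
    unfolding X2 by (intro Bochner_Integration.integrable_sum int)
  have iX: "integrable (measure_pmf M) X"
    unfolding X_def by (intro Bochner_Integration.integrable_sum int)
  have EX2: "measure_pmf.expectation M (\<lambda>\<omega>. (X \<omega>)\<^sup>2) = (\<Sum>i\<in>I. \<Sum>j\<in>I. measure_pmf.prob M (Ev i \<inter> Ev j))"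
    unfolding X2 by (simp add: Bochner_Integration.integral_sum int)
  have "measure_pmf.prob M {\<omega> \<in> space (measure_pmf M). \<mu> \<le> \<bar>X \<omega> - measure_pmf.expectation M X\<bar>}
      \<le> measure_pmf.variance M X / \<mu>\<^sup>2"
    by (rule measure_pmf.Chebyshev_inequality) (use iX2 mu in auto)
  also have "measure_pmf.variance M X = measure_pmf.expectation M (\<lambda>\<omega>. (X \<omega>)\<^sup>2) - \<mu>\<^sup>2"
    using measure_pmf.variance_eq[OF iX iX2] EX by simp
  also have "\<dots> / \<mu>\<^sup>2 \<le> ((1 + \<epsilon>) * \<mu>\<^sup>2 - \<mu>\<^sup>2) / \<mu>\<^sup>2"
    using pairs EX2 by (intro divide_right_mono) auto
  also have "\<dots> = \<epsilon>" using mu(2) by (simp add: field_simps)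
  finally have ch: "measure_pmf.prob M {\<omega>. \<mu> \<le> \<bar>X \<omega> - \<mu>\<bar>} \<le> \<epsilon>" using EX by simp
  have "X \<omega> = 0" if "\<omega> \<notin> (\<Union>i\<in>I. Ev i)" for \<omega>
    using that unfolding X_def by (intro sum.neutral) auto
  then have "- (\<Union>i\<in>I. Ev i) \<subseteq> {\<omega>. \<mu> \<le> \<bar>X \<omega> - \<mu>\<bar>}" using mu(2) by auto
  then have "measure_pmf.prob M (- (\<Union>i\<in>I. Ev i)) \<le> \<epsilon>"
    using ch measure_pmf.finite_measure_mono[of "- (\<Union>i\<in>I. Ev i)" "{\<omega>. \<mu> \<le> \<bar>X \<omega> - \<mu>\<bar>}" M] by auto
  then show ?thesis
    using measure_pmf.prob_compl[of "\<Union>i\<in>I. Ev i" M] by (simp add: Compl_eq_Diff_UNIV)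
qed

lemma prob_many_failures:
  fixes M :: "'a pmf" and Ok :: "'i \<Rightarrow> 'a set"
  assumes "finite I" "t > 0" "\<And>i. i \<in> I \<Longrightarrow> measure_pmf.prob M (Ok i) \<ge> 1 - \<epsilon>"
  shows "measure_pmf.prob M {\<omega>. real (card {i \<in> I. \<omega> \<notin> Ok i}) < t} \<ge> 1 - \<epsilon> * real (card I) / t"
proof -
  define X :: "'a \<Rightarrow> real" where "X \<omega> = (\<Sum>i\<in>I. indicator (- Ok i) \<omega>)" for \<omega>
  have int: "integrable (measure_pmf M) (indicator A :: 'a \<Rightarrow> real)" for A
    by (rule measure_pmf.integrable_const_bound[where B = 1]) (auto simp: indicator_def)
  have Xc: "X \<omega> = real (card {i \<in> I. \<omega> \<notin> Ok i})" for \<omega>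
  proof -
    have "real (card {i \<in> I. \<omega> \<notin> Ok i}) = (\<Sum>i\<in>I. if \<omega> \<notin> Ok i then 1 else 0)"
      using assms(1) by (subst sum.inter_filter[symmetric]) auto
    also have "\<dots> = X \<omega>" unfolding X_def by (intro sum.cong) auto
    finally show ?thesis by simp
  qed
  have "measure_pmf.prob M {\<omega> \<in> space (measure_pmf M). t \<le> X \<omega>} \<le> measure_pmf.expectation M X / t"
    by (rule integral_Markov_inequality_measure[where A="{}"])
       (use assms int in \<open>auto simp: X_def sum_nonneg\<close>)
  also have "measure_pmf.expectation M X = (\<Sum>i\<in>I. measure_pmf.prob M (- Ok i))"
    unfolding X_def by (subst Bochner_Integration.integral_sum) (auto intro: int)
  also have "\<dots> \<le> (\<Sum>i\<in>I. \<epsilon>)"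
  proof (rule sum_mono)
    fix i assume "i \<in> I"
    then show "measure_pmf.prob M (- Ok i) \<le> \<epsilon>"
      using assms(3)[of i] measure_pmf.prob_compl[of "Ok i" M] by (simp add: Compl_eq_Diff_UNIV)
  qed
  also have "\<dots> = \<epsilon> * real (card I)" by simp
  finally have "measure_pmf.prob M {\<omega>. t \<le> X \<omega>} \<le> \<epsilon> * real (card I) / t"
    using assms(2) by (simp add: divide_right_mono)
  moreover have "{\<omega>. real (card {i \<in> I. \<omega> \<notin> Ok i}) < t} = UNIV - {\<omega>. t \<le> X \<omega>}"
    by (auto simp: Xc)
  ultimately show ?thesis
    using measure_pmf.prob_compl[of "{\<omega>. t \<le> X \<omega>}" M] by simp
qed

definition random_edges :: "nat \<Rightarrow> real \<Rightarrow> nat set set pmf" where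
  "random_edges n p = map_pmf (\<lambda>X. {e \<in> pairs_of {1..n}. X e})
     (Pi_pmf (pairs_of {1..n}) False (\<lambda>_. bernoulli_pmf p))"

lemma gnp_eq_random_edges: "gnp n p = map_pmf (\<lambda>Y. \<lparr>verts = {1..n}, edges = Y\<rparr>) (random_edges n p)"
  by (simp add: gnp_def random_edges_def map_pmf_comp o_def)

lemma set_random_edges: "Y \<in> set_pmf (random_edges n p) \<Longrightarrow> Y \<subseteq> pairs_of {1..n}"
  by (auto simp: random_edges_def)

lemma prob_random_edges_superset:
  assumes "A \<subseteq> pairs_of {1..n}" "0 \<le> p" "p \<le> 1"
  shows "measure_pmf.prob (random_edges n p) {Y. A \<subseteq> Y} = p ^ card A"
proof -
  let ?P = "pairs_of {1..n}"
  have fin: "finite ?P" by (simp add: finite_pairs_of)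
  have "measure_pmf.prob (random_edges n p) {Y. A \<subseteq> Y}
     = measure_pmf.prob (Pi_pmf ?P False (\<lambda>_. bernoulli_pmf p)) (Pi ?P (\<lambda>e. if e \<in> A then {True} else UNIV))"
    unfolding random_edges_def measure_map_pmf
    using assms(1) by (intro arg_cong[where f = "measure_pmf.prob _"]) (auto simp: Pi_def)
  also have "\<dots> = (\<Prod>e\<in>?P. if e \<in> A then p else 1)"
    using assms by (subst measure_Pi_pmf_Pi[OF fin])
       (intro prod.cong, auto simp: measure_pmf_single)
  also have "\<dots> = p ^ card A"
    using assms(1) fin by (subst prod.inter_restrict[symmetric]) (auto simp: Int_absorb1)
  finally show ?thesis .
qed

text \<open>
An edge of the union of two independent rounds is either present in the first round or decided by the
second one. Keeping the result of the first round visible allows conditioning on it.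
\<close>

lemma bernoulli_sprinkle:
  assumes "0 \<le> p" "p \<le> 1" "0 \<le> q" "q \<le> 1"
  shows "bernoulli_pmf (p + q - p * q) =
    bind_pmf (bernoulli_pmf p) (\<lambda>x. if x then return_pmf True else bernoulli_pmf q)"
proof (rule pmf_eqI)
  fix b
  have "0 \<le> p + q * (1 - p)" using assms by simp
  moreover have "p + q - p * q \<le> 1"
    using mult_nonneg_nonneg[of "1 - p" "1 - q"] assms by (simp add: algebra_simps)
  ultimately show "pmf (bernoulli_pmf (p + q - p * q)) b =
      pmf (bernoulli_pmf p \<bind> (\<lambda>x. if x then return_pmf True else bernoulli_pmf q)) b"
    using assms by (cases b) (auto simp: pmf_bind algebra_simps)
qed

text \<open>
Once the first round \<open>Y\<close> is revealed, the edges of the union are still independent: those of \<open>Y\<close> are present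
and every other pair is decided by a fresh coin of bias \<open>q\<close>. A good first round can therefore be completed
by a second round whose success is estimated for each fixed \<open>Y\<close>.
\<close>

lemma random_edges_sprinkle:
  assumes pq: "0 \<le> p" "p \<le> 1" "0 \<le> q" "q \<le> 1" and "0 \<le> \<beta>"
    and good: "measure_pmf.prob (random_edges n p) Good \<ge> \<alpha>"
    and extend: "\<And>Y. Y \<in> Good \<Longrightarrow> Y \<subseteq> pairs_of {1..n} \<Longrightarrow>
      measure_pmf.prob (Pi_pmf (pairs_of {1..n}) False
        (\<lambda>e. if e \<in> Y then return_pmf True else bernoulli_pmf q))
        {X. {e \<in> pairs_of {1..n}. X e} \<in> S} \<ge> \<beta>"
  shows "measure_pmf.prob (random_edges n (p + q - p * q)) S \<ge> \<alpha> * \<beta>"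
proof -
  let ?P = "pairs_of {1..n}"
  have fin: "finite ?P" by (simp add: finite_pairs_of)
  let ?K = "\<lambda>Y. Pi_pmf ?P False (\<lambda>e. if e \<in> Y then return_pmf True else bernoulli_pmf q)"
  let ?g = "\<lambda>X :: nat set \<Rightarrow> bool. {e \<in> ?P. X e}"
  have "random_edges n (p + q - p * q) =
      map_pmf ?g (Pi_pmf ?P False (\<lambda>_. bernoulli_pmf p) \<bind>
         (\<lambda>X. Pi_pmf ?P False (\<lambda>e. if X e then return_pmf True else bernoulli_pmf q)))"
    unfolding random_edges_def bernoulli_sprinkle[OF pq]
    by (subst Pi_pmf_bind[OF fin, where d' = False]) simp
  also have "\<dots> = map_pmf ?g (Pi_pmf ?P False (\<lambda>_. bernoulli_pmf p) \<bind> (\<lambda>X. ?K (?g X)))"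
    by (intro arg_cong[where f = "map_pmf ?g"] bind_pmf_cong refl Pi_pmf_cong) auto
  also have "\<dots> = random_edges n p \<bind> (\<lambda>Y. map_pmf ?g (?K Y))"
    by (simp add: random_edges_def map_bind_pmf bind_map_pmf)
  finally have eq: "random_edges n (p + q - p * q) = random_edges n p \<bind> (\<lambda>Y. map_pmf ?g (?K Y))" .
  have "ennreal (\<alpha> * \<beta>) \<le> ennreal (measure_pmf.prob (random_edges n p) Good * \<beta>)"
    using good \<open>0 \<le> \<beta>\<close> by (intro ennreal_leI mult_right_mono) auto
  also have "\<dots> = (\<integral>\<^sup>+Y. ennreal \<beta> * indicator Good Y \<partial>random_edges n p)"
    using \<open>0 \<le> \<beta>\<close> by (subst nn_integral_cmult_indicator)
      (auto simp: measure_pmf.emeasure_eq_measure ennreal_mult'' mult.commute)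
  also have "\<dots> \<le> (\<integral>\<^sup>+Y. emeasure (map_pmf ?g (?K Y)) S \<partial>random_edges n p)"
  proof (rule nn_integral_mono_AE, rule AE_pmfI)
    fix Y assume "Y \<in> set_pmf (random_edges n p)"
    then show "ennreal \<beta> * indicator Good Y \<le> emeasure (map_pmf ?g (?K Y)) S"
      using extend[of Y] set_random_edges[of Y n p]
      by (cases "Y \<in> Good") (auto simp: measure_pmf.emeasure_eq_measure measure_map_pmf vimage_def)
  qed
  also have "\<dots> = emeasure (random_edges n (p + q - p * q)) S"
    by (simp add: eq)
  finally show ?thesis
    by (simp add: measure_pmf.emeasure_eq_measure)
qed

section \<open>Density of strictly balanced graphs\<close>

lemma edges_within_pair: "card {e \<in> pairs_of W. e \<subseteq> T} \<le> 1" if "card T = 2"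
proof -
  have "finite T" using that by (simp add: card_ge_0_finite)
  then have "e = T" if "e \<in> pairs_of W" "e \<subseteq> T" for e
    using that \<open>card T = 2\<close> card_subset_eq[of T e] by (auto simp: pairs_of_def)
  then have "{e \<in> pairs_of W. e \<subseteq> T} \<subseteq> {T}" by blast
  then show ?thesis using card_mono[of "{T}"] by fastforce
qed

text \<open>
The facts about a strictly balanced graph that the ladder argument uses, with \<open>lm\<close> in the role of \<open>\<lambda>\<close>:
two disjoint edges \<open>ab\<close> and \<open>cd\<close>, through which consecutive copies of the graph are glued, and
\<open>\<lambda> > 1\<close>. The set \<open>U\<close> below collects the vertices and \<open>R\<close> the edges that one rung adds.
\<close>

locale balanced_rung =
  fixes V :: "'a set" and E :: "'a set set" and a b c d :: 'a and lm :: real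
  assumes finV: "finite V" and EV: "E \<subseteq> pairs_of V"
    and abE: "{a, b} \<in> E" and cdE: "{c, d} \<in> E" and disj: "{a, b} \<inter> {c, d} = {}"
    and lm1: "1 < lm" and lmE: "lm * (real (card V) - 2) = real (card E) - 2"
    and sparse: "\<And>T. T \<subseteq> V \<Longrightarrow> 3 \<le> card T \<Longrightarrow> card T < card V \<Longrightarrow>
      real (card {e \<in> E. e \<subseteq> T}) - 1 < lm * (real (card T) - 2)"
begin

definition U where "U = V - {a, b}"
definition R where "R = E - {{a, b}, {c, d}}"

lemma ab: "a \<in> V" "b \<in> V" "a \<noteq> b" and cd: "c \<in> V" "d \<in> V" "c \<noteq> d"
  using subsetD[OF EV abE] subsetD[OF EV cdE] unfolding doubleton_in_pairs_of by blast+

lemma abcd: "a \<noteq> c" "a \<noteq> d" "b \<noteq> c" "b \<noteq> d" using disj by auto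

lemma cdU: "c \<in> U" "d \<in> U" using cd abcd by (auto simp: U_def)

lemma finE: "finite E" using EV finV finite_pairs_of finite_subset by blast
lemma finR: "finite R" and finU: "finite U" using finE finV by (auto simp: R_def U_def)

lemma cardV: "card V \<ge> 4"
proof -
  have "card {a, b, c, d} \<le> card V" using ab cd finV by (intro card_mono) auto
  then show ?thesis using ab cd abcd by simp
qed

lemma cardU: "card U = card V - 2"
  unfolding U_def using ab by (subst card_Diff_subset) auto

lemma ab_ne_cd: "{a, b} \<noteq> {c, d}" using disj by auto

lemma cardE: "card E \<ge> 3"
proof -
  have V4: "real (card V) \<ge> 4" using cardV by simp
  then have "1 * (real (card V) - 2) < lm * (real (card V) - 2)"
    using lm1 by (intro mult_strict_right_mono) auto
  then have "real (card E) > 2" unfolding lmE using V4 by simp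
  then show ?thesis by simp
qed

lemma cardR: "card R = card E - 2"
  unfolding R_def using abE cdE ab_ne_cd finE by (subst card_Diff_subset) auto

lemma R_pairs: "R \<subseteq> pairs_of V" using EV by (auto simp: R_def)

lemma lm_cardU: "lm * real (card U) = real (card R)"
  using lmE cardV cardE cardU cardR by (simp add: of_nat_diff)

definition e_in where "e_in T = card {e \<in> R. e \<subseteq> T}"

lemma edges_le: "real (card {e \<in> E. e \<subseteq> T}) \<le> 1 + lm * (real (card T) - 2)"
  if "T \<subseteq> V" "2 \<le> card T" "card T < card V"
proof (cases "card T = 2")
  case True
  have "card {e \<in> E. e \<subseteq> T} \<le> card {e \<in> pairs_of V. e \<subseteq> T}"
    using EV finite_pairs_of[OF finV] by (intro card_mono) auto
  then show ?thesis using edges_within_pair[OF True, of V] True by simp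
next
  case False
  then show ?thesis using sparse[of T] that by simp
qed

lemma edges_le':
  assumes "T \<subseteq> V" "T \<noteq> {}" "card T < card V"
  shows "real (card {e \<in> E. e \<subseteq> T}) \<le> lm * (real (card T) - 1)"
proof (cases "card T = 1")
  case True
  have "e \<notin> E" if "e \<subseteq> T" for e
  proof
    assume "e \<in> E"
    then have "card e = 2" using EV by (auto simp: pairs_of_def)
    moreover have "card e \<le> 1"
      using card_mono[OF finite_subset[OF assms(1) finV] that] True by simp
    ultimately show False by simp
  qed
  then have none: "{e \<in> E. e \<subseteq> T} = {}" by blast
  show ?thesis unfolding none using True by simp
next
  case False
  moreover have "card T \<noteq> 0" using assms finite_subset[OF assms(1) finV] by simp
  ultimately have "card T \<ge> 2" by linarith
  then have "real (card {e \<in> E. e \<subseteq> T}) \<le> 1 + lm * (real (card T) - 2)"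
    using edges_le assms by blast
  also have "\<dots> \<le> lm * (real (card T) - 1)" using lm1 by (simp add: algebra_simps)
  finally show ?thesis .
qed

text \<open>
If no edge of \<open>R\<close> left \<open>W\<close>, then only \<open>cd\<close> could join \<open>W\<close> to its complement. The density bounds for the
two sides then add up to fewer edges than the graph has. Consequently the position of a rung in a
sparse graph is determined by its base pair up to boundedly many choices.
\<close>

lemma rung_connected:
  assumes "{a, b} \<subseteq> W" "W \<subset> V"
  shows "\<exists>e\<in>R. e \<inter> W \<noteq> {} \<and> e - W \<noteq> {}"
proof (rule ccontr)
  assume no: "\<not> ?thesis"
  let ?S = "V - W"
  have finW: "finite W" using assms(2) finV finite_subset by blast
  have S: "?S \<noteq> {}" using assms by blast
  have cS: "card ?S = card V - card W" using assms finW by (intro card_Diff_subset) auto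
  have cW: "2 \<le> card W" using card_mono[OF finW assms(1)] ab by simp
  have cWV: "card W < card V" using assms(2) finV psubset_card_mono by blast
  have "E \<subseteq> {e \<in> E. e \<subseteq> W} \<union> {e \<in> E. e \<subseteq> ?S} \<union> {{c, d}}"
  proof
    fix e assume e: "e \<in> E"
    then have "e \<subseteq> V" using EV by (auto simp: pairs_of_def)
    show "e \<in> {e \<in> E. e \<subseteq> W} \<union> {e \<in> E. e \<subseteq> ?S} \<union> {{c, d}}"
    proof (cases "e \<in> R")
      case True
      then show ?thesis using no e \<open>e \<subseteq> V\<close> by auto
    next
      case False
      then show ?thesis using e assms(1) by (auto simp: R_def)
    qed
  qed
  then have "card E \<le> card ({e \<in> E. e \<subseteq> W} \<union> {e \<in> E. e \<subseteq> ?S} \<union> {{c, d}})"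
    using finE by (intro card_mono) auto
  also have "\<dots> \<le> card {e \<in> E. e \<subseteq> W} + card {e \<in> E. e \<subseteq> ?S} + 1"
    using card_Un_le[of "{e \<in> E. e \<subseteq> W} \<union> {e \<in> E. e \<subseteq> ?S}" "{{c, d}}"]
      card_Un_le[of "{e \<in> E. e \<subseteq> W}" "{e \<in> E. e \<subseteq> ?S}"] by simp
  finally have "real (card E) \<le> real (card {e \<in> E. e \<subseteq> W}) + real (card {e \<in> E. e \<subseteq> ?S}) + 1"
    by linarith
  also have "\<dots> \<le> (1 + lm * (real (card W) - 2)) + lm * (real (card ?S) - 1) + 1"
    using edges_le[of W] edges_le'[of ?S] assms cW cWV S cS by auto
  also have "\<dots> = 2 + lm * (real (card V) - 3)"
    using cS cWV by (simp add: algebra_simps)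
  also have "\<dots> < 2 + lm * (real (card V) - 2)" using lm1 by simp
  finally show False using lmE by simp
qed

lemma e_in_no_new: "e_in T = 0" if "T \<subseteq> {a, b}"
proof -
  have none: "{e \<in> R. e \<subseteq> T} = {}"
  proof (rule ccontr)
    assume "{e \<in> R. e \<subseteq> T} \<noteq> {}"
    then obtain e where "e \<in> R" "e \<subseteq> T" by blast
    with that have e: "e \<in> R" "e \<subseteq> {a, b}" by simp_all
    then have "card e = 2" using R_pairs by (auto simp: pairs_of_def)
    then have "e = {a, b}" using ab by (intro card_subset_eq[OF _ e(2)]) simp_all
    then show False using e by (simp add: R_def)
  qed
  show ?thesis unfolding e_in_def none by simp
qed

text \<open>
The gain of a partial overlap. If both base vertices and the new vertices in \<open>S\<close> lie in a given set, the
rung shares at most \<open>e_in (S \<union> {a, b})\<close> edges with a graph on that set. Balancedness of the subgraph spanned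
by these vertices, which also contains the edge \<open>ab\<close> outside \<open>R\<close>, shows that fixing \<open>|S|\<close> vertices costs
more than the shared edges save.
\<close>

lemma e_in_with_base:
  assumes "S \<subseteq> U" "S \<noteq> {}" "S \<noteq> U"
  shows "real (e_in (S \<union> {a, b})) < lm * real (card S)"
proof -
  let ?T = "S \<union> {a, b}"
  have fS: "finite S" using assms finU finite_subset by blast
  have cS: "card ?T = card S + 2"
    using assms ab fS by (subst card_Un_disjoint) (auto simp: U_def)
  have "?T \<subset> V" using assms ab by (auto simp: U_def)
  then have lt: "card ?T < card V" using finV psubset_card_mono by blast
  have "card S \<ge> 1" using assms fS by (simp add: Suc_leI card_gt_0_iff)
  then have "real (card {e \<in> E. e \<subseteq> ?T}) - 1 < lm * (real (card ?T) - 2)"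
    using sparse[of ?T] lt \<open>?T \<subset> V\<close> cS by auto
  moreover have "insert {a, b} {e \<in> R. e \<subseteq> ?T} \<subseteq> {e \<in> E. e \<subseteq> ?T}"
    using abE by (auto simp: R_def)
  then have "card (insert {a, b} {e \<in> R. e \<subseteq> ?T}) \<le> card {e \<in> E. e \<subseteq> ?T}"
    using finE by (intro card_mono) auto
  then have "e_in ?T + 1 \<le> card {e \<in> E. e \<subseteq> ?T}"
    using finR by (simp add: e_in_def R_def)
  ultimately show ?thesis using cS by simp
qed

text \<open>
A rung whose base pair is not inside a given set, while its exit pair \<open>cd\<close> is, saves fewer edges by a whole
vertex: now \<open>cd\<close> is an edge of the spanned subgraph that does not count, and at most one base vertex comes
for free.
\<close>

lemma e_in_with_exit:
  assumes "S \<subseteq> U" "c \<in> S" "d \<in> S" "T \<subseteq> {a, b}" "T \<noteq> {a, b}"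
  shows "real (e_in (S \<union> T)) \<le> lm * (real (card S) - 1)"
proof -
  let ?T = "S \<union> T"
  have fS: "finite S" using assms finU finite_subset by blast
  have "card T \<le> 1"
  proof -
    have "card T < card {a, b}" using assms by (intro psubset_card_mono) auto
    then show ?thesis using ab by simp
  qed
  then have cT: "card ?T \<le> card S + 1" using card_Un_le[of S T] by simp
  have "?T \<subseteq> V" using assms ab by (auto simp: U_def)
  moreover have "?T \<noteq> V" using assms ab by (auto simp: U_def)
  ultimately have lt: "card ?T < card V" using finV psubset_card_mono by blast
  have "card {c, d} \<le> card ?T"
    using assms fS finite_subset[OF assms(4)] by (intro card_mono) auto
  then have "real (card {e \<in> E. e \<subseteq> ?T}) \<le> 1 + lm * (real (card ?T) - 2)"
    using edges_le[of ?T] lt \<open>?T \<subseteq> V\<close> cd by simp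
  also have "\<dots> \<le> 1 + lm * (real (card S) - 1)" using cT lm1 by simp
  finally have "real (card {e \<in> E. e \<subseteq> ?T}) \<le> 1 + lm * (real (card S) - 1)" .
  moreover have "insert {c, d} {e \<in> R. e \<subseteq> ?T} \<subseteq> {e \<in> E. e \<subseteq> ?T}"
    using cdE assms by (auto simp: R_def)
  then have "card (insert {c, d} {e \<in> R. e \<subseteq> ?T}) \<le> card {e \<in> E. e \<subseteq> ?T}"
    using finE by (intro card_mono) auto
  then have "e_in ?T + 1 \<le> card {e \<in> E. e \<subseteq> ?T}"
    using finR by (simp add: e_in_def R_def)
  ultimately show ?thesis by simp
qed

text \<open>
There are finitely many proper overlaps, so the strict inequalities hold with a uniform margin. It becomes
the exponent of \<open>n\<close> that a partial overlap costs.
\<close>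

lemma density_gap:
  obtains \<gamma> where "0 < \<gamma>" "\<gamma> \<le> 1 / lm"
    "\<And>S. S \<subseteq> U \<Longrightarrow> S \<noteq> {} \<Longrightarrow> S \<noteq> U \<Longrightarrow> real (e_in (S \<union> {a, b})) \<le> lm * (real (card S) - \<gamma>)"
proof -
  define B where "B = insert (1 / lm) ((\<lambda>S. real (card S) - real (e_in (S \<union> {a, b})) / lm) ` {S. S \<subseteq> U \<and> S \<noteq> {} \<and> S \<noteq> U})"
  have finB: "finite B" using finU by (simp add: B_def)
  have pos: "x > 0" if "x \<in> B" for x
  proof -
    have "x = 1 / lm \<or> (\<exists>S. S \<subseteq> U \<and> S \<noteq> {} \<and> S \<noteq> U \<and>
        x = real (card S) - real (e_in (S \<union> {a, b})) / lm)"
      using that unfolding B_def by auto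
    then show ?thesis
    proof (elim disjE exE conjE)
      fix S assume S: "S \<subseteq> U" "S \<noteq> {}" "S \<noteq> U"
        and x: "x = real (card S) - real (e_in (S \<union> {a, b})) / lm"
      have "real (e_in (S \<union> {a, b})) / lm < real (card S)"
        using e_in_with_base[OF S] lm1 by (simp add: pos_divide_less_eq mult.commute)
      then show ?thesis using x by simp
    qed (use lm1 in simp)
  qed
  show ?thesis
  proof (rule that[of "Min B"])
    show "0 < Min B" by (rule pos, rule Min_in[OF finB]) (simp add: B_def)
    show "Min B \<le> 1 / lm" using finB by (intro Min_le) (auto simp: B_def)
    fix S assume "S \<subseteq> U" "S \<noteq> {}" "S \<noteq> U"
    then have "Min B \<le> real (card S) - real (e_in (S \<union> {a, b})) / lm"
      using finB by (intro Min_le) (auto simp: B_def)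
    then show "real (e_in (S \<union> {a, b})) \<le> lm * (real (card S) - Min B)"
      using lm1 by (simp add: field_simps)
  qed
qed

end

text \<open>
A path with two edges, which exists by the degree condition, is a subgraph on three vertices, so
balancedness gives \<open>\<lambda> > 1\<close>. If all edges met a fixed edge \<open>ab\<close>, then by the degree condition every other
vertex would be joined to both \<open>a\<close> and \<open>b\<close>, and two such vertices would provide disjoint edges after all.
\<close>

lemma balanced_rung_exists:
  fixes H :: "'a sgraph"
  assumes H: "finite_simple_graph H" and v: "num_verts H \<ge> 4"
    and sb: "strictly_balanced H" and deg: "min_degree H \<ge> 2"
  obtains a b c d where "balanced_rung (verts H) (edges H) a b c d (lam H)"
proof -
  let ?V = "verts H" and ?E = "edges H"
  have finV: "finite ?V" and EV: "?E \<subseteq> pairs_of ?V" using H by (auto simp: finite_simple_graph_def)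
  have finE: "finite ?E" using EV finV finite_pairs_of finite_subset by blast
  have V4: "card ?V \<ge> 4" using v by (simp add: num_verts_def)
  have sparse: "real (card {e \<in> ?E. e \<subseteq> T}) - 1 < lam H * (real (card T) - 2)"
    if T: "T \<subseteq> ?V" "3 \<le> card T" "card T < card ?V" for T
  proof -
    let ?F = "\<lparr>verts = T, edges = {e \<in> ?E. e \<subseteq> T}\<rparr>"
    have "subgraph ?F H"
      using T EV finite_subset[OF T(1) finV]
      by (auto simp: subgraph_def finite_simple_graph_def pairs_of_def)
    then have "(real (num_edges ?F) - 1) / (real (num_verts ?F) - 2) < lam H"
      using sb T unfolding strictly_balanced_def num_verts_def by auto
    then show ?thesis using T(2) by (simp add: num_edges_def num_verts_def field_simps)
  qed
  have nbr: "\<exists>w. w \<noteq> y \<and> {x, w} \<in> ?E" if "x \<in> ?V" for x y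
  proof -
    have "Min (degree H ` ?V) \<le> degree H x" using that finV by (intro Min_le) auto
    then have "2 \<le> degree H x" using deg by (simp add: min_degree_def)
    then have two: "2 \<le> card {e \<in> ?E. x \<in> e}" by (simp add: degree_def)
    have "\<not> {e \<in> ?E. x \<in> e} \<subseteq> {{x, y}}"
    proof
      assume "{e \<in> ?E. x \<in> e} \<subseteq> {{x, y}}"
      from card_mono[OF _ this] two show False by simp
    qed
    then obtain e where e: "e \<in> ?E" "x \<in> e" "e \<noteq> {x, y}" by blast
    then have "card e = 2" using EV by (auto simp: pairs_of_def)
    then obtain w where "e = {x, w}" using e(2) by (auto simp: card_2_iff)
    then show ?thesis using e by (intro exI[of _ w]) auto
  qed
  have edgeV: "x \<in> ?V \<and> y \<in> ?V \<and> x \<noteq> y" if "{x, y} \<in> ?E" for x y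
    using subsetD[OF EV that] by (simp add: doubleton_in_pairs_of)
  obtain a where a: "a \<in> ?V" using V4 by (metis card.empty all_not_in_conv not_numeral_le_zero)
  obtain b where b: "{a, b} \<in> ?E" using nbr[OF a] by blast
  obtain z where z: "z \<noteq> b" "{a, z} \<in> ?E" using nbr[OF a] by blast
  have lm1: "1 < lam H"
  proof -
    let ?T = "{a, b, z}"
    have cT: "card ?T = 3" using z edgeV[OF b] edgeV[OF z(2)] by auto
    have "{{a, b}, {a, z}} \<subseteq> {e \<in> ?E. e \<subseteq> ?T}" using b z by auto
    then have "card {{a, b}, {a, z}} \<le> card {e \<in> ?E. e \<subseteq> ?T}" using finE by (intro card_mono) auto
    moreover have "card {{a, b}, {a, z}} = 2" using z by (auto simp: doubleton_eq_iff)
    ultimately have "2 \<le> card {e \<in> ?E. e \<subseteq> ?T}" by simp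
    moreover have "real (card {e \<in> ?E. e \<subseteq> ?T}) - 1 < lam H * (real (card ?T) - 2)"
      using sparse[of ?T] edgeV[OF b] edgeV[OF z(2)] cT V4 by auto
    ultimately show ?thesis using cT by simp
  qed
  have lmE: "lam H * (real (card ?V) - 2) = real (card ?E) - 2"
    using V4 by (simp add: lam_def num_verts_def num_edges_def)
  have rung: "balanced_rung ?V ?E a' b' c d (lam H)"
    if "{a', b'} \<in> ?E" "{c, d} \<in> ?E" "{a', b'} \<inter> {c, d} = {}" for a' b' c d
    by (intro balanced_rung.intro finV EV that lm1 lmE sparse)
  have "\<exists>x y w z. {x, y} \<in> ?E \<and> {w, z} \<in> ?E \<and> {x, y} \<inter> {w, z} = {}"
  proof (rule ccontr)
    assume no: "\<not> ?thesis"
    have both: "{w, a} \<in> ?E \<and> {w, b} \<in> ?E" if w: "w \<in> ?V" "w \<noteq> a" "w \<noteq> b" for w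
    proof -
      have ab: "w' = a \<or> w' = b" if "{w, w'} \<in> ?E" for w'
      proof (rule ccontr)
        assume "\<not> ?thesis"
        then have "{a, b} \<inter> {w, w'} = {}" using w by auto
        then show False using no b that by blast
      qed
      obtain w1 where "w1 \<noteq> a" "{w, w1} \<in> ?E" using nbr[OF w(1), of a] by blast
      moreover obtain w2 where "w2 \<noteq> b" "{w, w2} \<in> ?E" using nbr[OF w(1), of b] by blast
      ultimately show ?thesis using ab[of w1] ab[of w2] by auto
    qed
    have "card (?V - {a, b}) \<ge> 2"
      using V4 finV card_Diff_subset[of "{a, b}" ?V] edgeV[OF b] by auto
    then obtain T where "T \<subseteq> ?V - {a, b}" "card T = 2" by (rule obtain_subset_with_card_n)
    then obtain w z where wz: "w \<in> ?V - {a, b}" "z \<in> ?V - {a, b}" "w \<noteq> z"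
      by (auto simp: card_2_iff)
    then have "{w, a} \<in> ?E" "{z, b} \<in> ?E" using both by auto
    moreover have "{w, a} \<inter> {z, b} = {}" using wz edgeV[OF b] by auto
    ultimately show False using no by blast
  qed
  then obtain x y w z where "{x, y} \<in> ?E" "{w, z} \<in> ?E" "{x, y} \<inter> {w, z} = {}" by blast
  from that[OF rung[OF this]] show ?thesis .
qed

section \<open>Ladders\<close>

context balanced_rung begin

text \<open>
A rung on the base pair \<open>xy\<close> is given by the images \<open>\<phi>\<close> of its new vertices; \<open>place\<close> is the resulting
embedding of the whole vertex set. In \<open>ladders n L F\<close> the set \<open>F\<close> contains the vertices that are already
used, so that all vertices of a ladder are distinct and its number of edges is known exactly.
\<close>

definition place :: "nat \<Rightarrow> nat \<Rightarrow> ('a \<Rightarrow> nat) \<Rightarrow> 'a \<Rightarrow> nat" where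
  "place x y \<phi> u = (if u = a then x else if u = b then y else \<phi> u)"

definition rung_edges :: "nat \<Rightarrow> nat \<Rightarrow> ('a \<Rightarrow> nat) \<Rightarrow> nat set set" where
  "rung_edges x y \<phi> = (\<lambda>e. place x y \<phi> ` e) ` R"

definition rungs :: "nat \<Rightarrow> nat set \<Rightarrow> ('a \<Rightarrow> nat) set" where
  "rungs n F = {\<phi> \<in> U \<rightarrow>\<^sub>E {1..n}. inj_on \<phi> U \<and> \<phi> ` U \<inter> F = {}}"

primrec ladders :: "nat \<Rightarrow> nat \<Rightarrow> nat set \<Rightarrow> ('a \<Rightarrow> nat) list set" where
  "ladders n 0 F = {[]}"
| "ladders n (Suc L) F = (\<Union>\<phi>\<in>rungs n F. (#) \<phi> ` ladders n L (F \<union> \<phi> ` U))"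

primrec ladder_edges :: "('a \<Rightarrow> nat) list \<Rightarrow> nat \<Rightarrow> nat \<Rightarrow> nat set set" where
  "ladder_edges [] x y = {{x, y}}"
| "ladder_edges (\<phi> # B) x y = rung_edges x y \<phi> \<union> ladder_edges B (\<phi> c) (\<phi> d)"

definition new_verts :: "('a \<Rightarrow> nat) list \<Rightarrow> nat set" where
  "new_verts B = (\<Union>\<phi>\<in>set B. \<phi> ` U)"

lemma new_verts_simps [simp]: "new_verts [] = {}" "new_verts (\<phi> # B) = \<phi> ` U \<union> new_verts B"
  by (simp_all add: new_verts_def)

lemma finite_new_verts: "finite (new_verts B)"
  using finU by (simp add: new_verts_def)

lemma card_new_verts: "card (new_verts B) \<le> length B * card U"
proof (induction B)
  case (Cons \<phi> B)
  have "card (\<phi> ` U \<union> new_verts B) \<le> card (\<phi> ` U) + card (new_verts B)" by (rule card_Un_le)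
  then show ?case using Cons card_image_le[OF finU, of \<phi>] by simp
qed simp

lemma finite_rungs: "finite (rungs n F)"
proof -
  have "finite (U \<rightarrow>\<^sub>E {1..n})" using finU by (intro finite_PiE) auto
  then show ?thesis unfolding rungs_def by (rule rev_finite_subset) blast
qed

lemma finite_ladders: "finite (ladders n L F)"
  by (induction L arbitrary: F) (auto simp: finite_rungs)

lemma rungs_antimono: "F \<subseteq> F' \<Longrightarrow> rungs n F' \<subseteq> rungs n F"
  by (auto simp: rungs_def)

lemma rungsD:
  assumes "\<phi> \<in> rungs n F"
  shows "inj_on \<phi> U" "\<phi> ` U \<subseteq> {1..n}" "\<phi> ` U \<inter> F = {}" "\<phi> c \<in> \<phi> ` U" "\<phi> d \<in> \<phi> ` U" "\<phi> c \<noteq> \<phi> d"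
proof -
  show inj: "inj_on \<phi> U" and "\<phi> ` U \<subseteq> {1..n}" and "\<phi> ` U \<inter> F = {}"
    using assms unfolding rungs_def by blast+
  show "\<phi> c \<in> \<phi> ` U" "\<phi> d \<in> \<phi> ` U" using cdU by simp_all
  show "\<phi> c \<noteq> \<phi> d" using inj_on_eq_iff[OF inj cdU] cd by simp
qed

lemma place_simps [simp]: "place x y \<phi> a = x" "place x y \<phi> b = y"
  "u \<in> U \<Longrightarrow> place x y \<phi> u = \<phi> u"
  using ab by (auto simp: place_def U_def)

lemma in_V_iff: "u \<in> V \<longleftrightarrow> u = a \<or> u = b \<or> u \<in> U" using ab by (auto simp: U_def)

lemma place_image_V: "place x y \<phi> ` V = {x, y} \<union> \<phi> ` U"
proof -
  have "place x y \<phi> ` V = place x y \<phi> ` (insert a (insert b U))"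
    by (rule arg_cong[where f = "(`) (place x y \<phi>)"]) (auto simp: in_V_iff)
  also have "\<dots> = {x, y} \<union> place x y \<phi> ` U" by simp
  also have "place x y \<phi> ` U = \<phi> ` U" by (intro image_cong) simp_all
  finally show ?thesis .
qed

lemma inj_on_place:
  assumes "\<phi> \<in> rungs n F" "x \<in> F" "y \<in> F" "x \<noteq> y"
  shows "inj_on (place x y \<phi>) V"
proof -
  have new: "\<phi> u \<noteq> x" "\<phi> u \<noteq> y" if "u \<in> U" for u using that assms rungsD(3)[OF assms(1)] by auto
  have inj: "\<phi> u = \<phi> w \<longleftrightarrow> u = w" if "u \<in> U" "w \<in> U" for u w
    using that rungsD(1)[OF assms(1)] by (auto simp: inj_on_def)
  show ?thesis
  proof (rule inj_onI)
    fix u w assume "u \<in> V" "w \<in> V" and eq: "place x y \<phi> u = place x y \<phi> w"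
    then consider "u = a" | "u = b" | "u \<in> U" unfolding in_V_iff by blast
    then show "u = w"
    proof cases
      case 1
      then show ?thesis using eq new[of w] assms(4) \<open>w \<in> V\<close> unfolding in_V_iff by auto
    next
      case 2
      then show ?thesis using eq new[of w] assms(4) \<open>w \<in> V\<close> unfolding in_V_iff by auto
    next
      case 3
      then show ?thesis using eq new[of u] inj[of u w] \<open>w \<in> V\<close> unfolding in_V_iff by auto
    qed
  qed
qed

lemma inj_on_image_R:
  assumes "inj_on \<psi> V"
  shows "inj_on (\<lambda>e. \<psi> ` e) (insert {c, d} R)"
proof -
  have "insert {c, d} R \<subseteq> Pow V" using R_pairs cd by (auto simp: pairs_of_def)
  then show ?thesis using inj_on_subset[OF inj_on_image_Pow[OF assms]] by blast
qed

lemma card_rung_edges: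
  assumes "\<phi> \<in> rungs n F" "x \<in> F" "y \<in> F" "x \<noteq> y"
  shows "card (rung_edges x y \<phi>) = card R"
proof -
  have "inj_on (\<lambda>e. place x y \<phi> ` e) R"
    using inj_on_image_R[OF inj_on_place[OF assms]] by (rule inj_on_subset) auto
  then show ?thesis unfolding rung_edges_def by (rule card_image)
qed

lemma rung_edges_pairs:
  assumes "\<phi> \<in> rungs n F" "x \<in> F" "y \<in> F" "x \<noteq> y"
  shows "rung_edges x y \<phi> \<subseteq> pairs_of ({x, y} \<union> \<phi> ` U)"
proof
  fix f assume "f \<in> rung_edges x y \<phi>"
  then obtain e where e: "e \<in> R" "f = place x y \<phi> ` e" by (auto simp: rung_edges_def)
  then have "e \<in> pairs_of V" using R_pairs by blast
  then show "f \<in> pairs_of ({x, y} \<union> \<phi> ` U)"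
    unfolding e(2) using place_image_V by (intro pairs_of_image[OF inj_on_place[OF assms]]) simp_all
qed

lemma finite_rung_edges: "finite (rung_edges x y \<phi>)"
  using finR by (simp add: rung_edges_def)

lemma laddersE:
  assumes "B \<in> ladders n (Suc L) F"
  obtains \<phi> B' where "B = \<phi> # B'" "\<phi> \<in> rungs n F" "B' \<in> ladders n L (F \<union> \<phi> ` U)"
  using assms unfolding ladders.simps by blast

lemma ladder_verts:
  assumes "B \<in> ladders n L F"
  shows "length B = L \<and> new_verts B \<subseteq> {1..n} \<and> new_verts B \<inter> F = {}"
  using assms
proof (induction L arbitrary: F B)
  case (Suc L)
  from Suc.prems(1) obtain \<phi> B' where B: "B = \<phi> # B'" and \<phi>: "\<phi> \<in> rungs n F" and B': "B' \<in> ladders n L (F \<union> \<phi> ` U)"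
    by (rule laddersE)
  show ?case using Suc.IH[OF B'] rungsD[OF \<phi>] unfolding B by auto
qed simp

lemma ladder_edges_pairs:
  assumes "B \<in> ladders n L F" "x \<in> F" "y \<in> F" "x \<noteq> y"
  shows "ladder_edges B x y \<subseteq> pairs_of ({x, y} \<union> new_verts B)"
  using assms
proof (induction L arbitrary: F B x y)
  case 0
  then show ?case by (simp add: doubleton_in_pairs_of)
next
  case (Suc L)
  from Suc.prems(1) obtain \<phi> B' where B: "B = \<phi> # B'" and \<phi>: "\<phi> \<in> rungs n F" and B': "B' \<in> ladders n L (F \<union> \<phi> ` U)"
    by (rule laddersE)
  have "ladder_edges B' (\<phi> c) (\<phi> d) \<subseteq> pairs_of ({\<phi> c, \<phi> d} \<union> new_verts B')"
    by (rule Suc.IH[OF B']) (use rungsD[OF \<phi>] in auto)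
  also have "\<dots> \<subseteq> pairs_of ({x, y} \<union> new_verts B)"
    using rungsD(4,5)[OF \<phi>] unfolding B pairs_of_def by auto
  finally have "ladder_edges B' (\<phi> c) (\<phi> d) \<subseteq> pairs_of ({x, y} \<union> new_verts B)" .
  moreover have "rung_edges x y \<phi> \<subseteq> pairs_of ({x, y} \<union> new_verts B)"
    using rung_edges_pairs[OF \<phi> Suc.prems(2-4)] unfolding B pairs_of_def by auto
  ultimately show ?case unfolding B by simp
qed

text \<open>
A common edge would have to join the two exit vertices, the only vertices shared with the rest of the
ladder. But the exit pair is the image of \<open>cd\<close>, which is not an edge of the rung.
\<close>

lemma rung_edges_disjoint:
  assumes \<phi>: "\<phi> \<in> rungs n F" and B: "B \<in> ladders n L (F \<union> \<phi> ` U)" and xy: "x \<in> F" "y \<in> F" "x \<noteq> y"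
  shows "rung_edges x y \<phi> \<inter> ladder_edges B (\<phi> c) (\<phi> d) = {}"
proof (rule ccontr)
  assume "\<not> ?thesis"
  then obtain e where e: "e \<in> rung_edges x y \<phi>" "e \<in> ladder_edges B (\<phi> c) (\<phi> d)" by blast
  have "e \<in> pairs_of ({x, y} \<union> \<phi> ` U)" using rung_edges_pairs[OF \<phi> xy] e(1) by blast
  moreover have "e \<in> pairs_of ({\<phi> c, \<phi> d} \<union> new_verts B)"
    using ladder_edges_pairs[OF B, of "\<phi> c" "\<phi> d"] rungsD[OF \<phi>] e(2) by blast
  moreover have "({x, y} \<union> \<phi> ` U) \<inter> new_verts B = {}"
    using ladder_verts[OF B] xy by blast
  ultimately have "e \<subseteq> {\<phi> c, \<phi> d}" "card e = 2" unfolding pairs_of_def by blast+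
  then have "e = {\<phi> c, \<phi> d}" using rungsD(6)[OF \<phi>] by (intro card_subset_eq) simp_all
  then have "place x y \<phi> ` {c, d} \<in> (\<lambda>e. place x y \<phi> ` e) ` R"
    using e(1) cdU by (simp add: rung_edges_def)
  then have "{c, d} \<in> R"
    using inj_on_image_R[OF inj_on_place[OF \<phi> xy]] unfolding inj_on_def by blast
  then show False by (simp add: R_def)
qed

lemma finite_ladder_edges: "finite (ladder_edges B x y)"
  by (induction B arbitrary: x y) (auto simp: finite_rung_edges)

lemma card_ladder_edges:
  assumes "B \<in> ladders n L F" "x \<in> F" "y \<in> F" "x \<noteq> y"
  shows "card (ladder_edges B x y) = L * card R + 1"
  using assms
proof (induction L arbitrary: F B x y)
  case (Suc L)
  from Suc.prems(1) obtain \<phi> B' where B: "B = \<phi> # B'" and \<phi>: "\<phi> \<in> rungs n F" and B': "B' \<in> ladders n L (F \<union> \<phi> ` U)"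
    by (rule laddersE)
  have "card (ladder_edges B' (\<phi> c) (\<phi> d)) = L * card R + 1"
    by (rule Suc.IH[OF B']) (use rungsD[OF \<phi>] in auto)
  then show ?case
    unfolding B using rung_edges_disjoint[OF \<phi> B' Suc.prems(2-4)] card_rung_edges[OF \<phi> Suc.prems(2-4)]
    by (simp add: card_Un_disjoint finite_rung_edges finite_ladder_edges)
qed simp

lemma sum_ladders_Suc:
  "(\<Sum>B\<in>ladders n (Suc L) F. f B) = (\<Sum>\<phi>\<in>rungs n F. \<Sum>B\<in>ladders n L (F \<union> \<phi> ` U). f (\<phi> # B))"
proof -
  have "(\<Sum>B\<in>ladders n (Suc L) F. f B) = (\<Sum>\<phi>\<in>rungs n F. sum f ((#) \<phi> ` ladders n L (F \<union> \<phi> ` U)))"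
    unfolding ladders.simps
    by (rule sum.UNION_disjoint) (auto simp: finite_rungs finite_ladders)
  also have "\<dots> = (\<Sum>\<phi>\<in>rungs n F. \<Sum>B\<in>ladders n L (F \<union> \<phi> ` U). f (\<phi> # B))"
    by (rule sum.cong[OF refl], subst sum.reindex) auto
  finally show ?thesis .
qed

text \<open>
Infection travels from the last pair, which is an edge, back to the first one: each rung together with its
infected exit pair forms a copy of \<open>H\<close> that lacks only the base pair.
\<close>

lemma ladder_infected:
  assumes "B \<in> ladders n L F" "x \<in> F" "y \<in> F" "x \<noteq> y" "F \<subseteq> {1..n}" "ladder_edges B x y \<subseteq> Y"
  shows "{x, y} \<in> infected \<lparr>verts = V, edges = E\<rparr> n Y"
  using assms
proof (induction L arbitrary: F B x y)
  case 0
  then show ?case by (auto intro: infected.seed)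
next
  case (Suc L)
  from Suc.prems(1) obtain \<phi> B' where B: "B = \<phi> # B'" and \<phi>: "\<phi> \<in> rungs n F" and B': "B' \<in> ladders n L (F \<union> \<phi> ` U)"
    by (rule laddersE)
  let ?\<psi> = "place x y \<phi>" and ?H = "\<lparr>verts = V, edges = E\<rparr>"
  have cd_inf: "{\<phi> c, \<phi> d} \<in> infected ?H n Y"
    by (rule Suc.IH[OF B']) (use rungsD[OF \<phi>] Suc.prems B in auto)
  have "?\<psi> ` {a, b} \<in> infected ?H n Y"
  proof (rule infected.spread)
    show "inj_on ?\<psi> (verts ?H)" using inj_on_place[OF \<phi> Suc.prems(2-4)] by simp
    show "?\<psi> ` verts ?H \<subseteq> {1..n}"
      using place_image_V[of x y \<phi>] rungsD(2)[OF \<phi>] Suc.prems(2,3,5) by auto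
    show "{a, b} \<in> edges ?H" using abE by simp
    fix g assume g: "g \<in> edges ?H" "g \<noteq> {a, b}"
    show "?\<psi> ` g \<in> infected ?H n Y"
    proof (cases "g = {c, d}")
      case True
      then show ?thesis using cd_inf cdU by simp
    next
      case False
      then have "?\<psi> ` g \<in> rung_edges x y \<phi>" using g by (simp add: rung_edges_def R_def)
      then show ?thesis using Suc.prems(6) B by (auto intro: infected.seed)
    qed
  qed
  then show ?case by simp
qed

text \<open>
Crude lower bounds for the number of rungs and ladders; the lower order terms disappear because a ladder
uses only logarithmically many vertices.
\<close>

lemma card_rungs_ge:
  assumes "F \<subseteq> {1..n}"
  shows "(n - card F - card U) ^ card U \<le> card (rungs n F)"
proof -
  have finF: "finite F" using assms finite_subset by blast
  have "rungs n F = {\<phi> \<in> U \<rightarrow>\<^sub>E ({1..n} - F). inj_on \<phi> U}"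
    unfolding rungs_def by (auto simp: PiE_def Pi_def)
  then have "card (rungs n F) = prod ((-) (card ({1..n} - F))) {0..<card U}"
    using card_inj_on_subset_funcset[of U "{1..n} - F" U] finU by simp
  also have "card ({1..n} - F) = n - card F"
    using assms finF by (simp add: card_Diff_subset)
  finally have "card (rungs n F) = (\<Prod>i\<in>{0..<card U}. n - card F - i)" by simp
  moreover have "(\<Prod>i\<in>{0..<card U}. n - card F - card U) \<le> (\<Prod>i\<in>{0..<card U}. n - card F - i)"
    by (intro prod_mono) auto
  ultimately show ?thesis by simp
qed

lemma card_ladders_ge:
  assumes "F \<subseteq> {1..n}"
  shows "(n - card F - L * card U) ^ (L * card U) \<le> card (ladders n L F)"
  using assms
proof (induction L arbitrary: F)
  case (Suc L)
  let ?k = "n - card F - Suc L * card U"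
  have finF: "finite F" using Suc.prems finite_subset by blast
  have "?k ^ (L * card U) \<le> card (ladders n L (F \<union> \<phi> ` U))" if \<phi>: "\<phi> \<in> rungs n F" for \<phi>
  proof -
    have sub: "F \<union> \<phi> ` U \<subseteq> {1..n}" using rungsD(2)[OF \<phi>] Suc.prems by simp
    have "card (F \<union> \<phi> ` U) \<le> card F + card U"
      using card_Un_le[of F "\<phi> ` U"] card_image_le[OF finU, of \<phi>] by linarith
    then have "?k \<le> n - card (F \<union> \<phi> ` U) - L * card U" by simp
    then have "?k ^ (L * card U) \<le> (n - card (F \<union> \<phi> ` U) - L * card U) ^ (L * card U)"
      by (rule power_mono) simp
    also have "\<dots> \<le> card (ladders n L (F \<union> \<phi> ` U))" by (rule Suc.IH[OF sub])
    finally show ?thesis .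
  qed
  then have "(\<Sum>\<phi>\<in>rungs n F. ?k ^ (L * card U)) \<le> (\<Sum>\<phi>\<in>rungs n F. \<Sum>B\<in>ladders n L (F \<union> \<phi> ` U). 1)"
    by (intro sum_mono) simp
  also have "\<dots> = card (ladders n (Suc L) F)"
    using sum_ladders_Suc[of "\<lambda>_. 1 :: nat" n L F] by simp
  finally have "card (rungs n F) * ?k ^ (L * card U) \<le> card (ladders n (Suc L) F)" by simp
  moreover have "?k ^ card U \<le> card (rungs n F)"
    by (rule order_trans[OF power_mono card_rungs_ge[OF Suc.prems]]) auto
  then have "?k ^ card U * ?k ^ (L * card U) \<le> card (rungs n F) * ?k ^ (L * card U)"
    by (rule mult_right_mono) simp
  moreover have "?k ^ (Suc L * card U) = ?k ^ card U * ?k ^ (L * card U)"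
    by (simp only: mult_Suc power_add)
  ultimately show ?case by linarith
qed simp

text \<open>
A new vertex of a ladder lies in the rung where it is introduced and, if it belongs to the exit pair of that
rung, also in the next one. The case distinction makes the induction go through, as the base pair lies in one rung only.
\<close>

lemma ladder_degree_aux:
  assumes "B \<in> ladders n L F" "x \<in> F" "y \<in> F" "x \<noteq> y"
  shows "card {e \<in> ladder_edges B x y. z \<in> e} \<le> (if z \<in> {x, y} then 1 else 2) * card R + 1"
  using assms
proof (induction L arbitrary: F B x y)
  case 0
  have "card {e. e = {x, y} \<and> z \<in> e} \<le> card {{x, y}}" by (rule card_mono) auto
  then show ?case using 0 by simp
next
  case (Suc L)
  from Suc.prems(1) obtain \<phi> B' where B: "B = \<phi> # B'" and \<phi>: "\<phi> \<in> rungs n F" and B': "B' \<in> ladders n L (F \<union> \<phi> ` U)"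
    by (rule laddersE)
  let ?r = "{e \<in> rung_edges x y \<phi>. z \<in> e}" and ?l = "{e \<in> ladder_edges B' (\<phi> c) (\<phi> d). z \<in> e}"
  have "{e \<in> ladder_edges B x y. z \<in> e} = ?r \<union> ?l" unfolding B by auto
  then have le: "card {e \<in> ladder_edges B x y. z \<in> e} \<le> card ?r + card ?l"
    by (simp add: card_Un_le)
  have r: "card ?r \<le> card R"
    using card_mono[OF finite_rung_edges, of ?r x y \<phi>] card_rung_edges[OF \<phi> Suc.prems(2-4)] by auto
  have cdF: "\<phi> c \<in> F \<union> \<phi> ` U" "\<phi> d \<in> F \<union> \<phi> ` U" using rungsD[OF \<phi>] by auto
  have IH: "card ?l \<le> (if z \<in> {\<phi> c, \<phi> d} then 1 else 2) * card R + 1"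
    by (rule Suc.IH[OF B' cdF rungsD(6)[OF \<phi>]])
  have l0: "card ?l = 0" if "z \<notin> {\<phi> c, \<phi> d} \<union> new_verts B'"
  proof -
    have none: "?l = {}"
      using ladder_edges_pairs[OF B' cdF rungsD(6)[OF \<phi>]] that unfolding pairs_of_def by blast
    show ?thesis unfolding none by simp
  qed
  have r0: "card ?r = 0" if "z \<notin> {x, y} \<union> \<phi> ` U"
  proof -
    have none: "?r = {}"
      using rung_edges_pairs[OF \<phi> Suc.prems(2-4)] that unfolding pairs_of_def by blast
    show ?thesis unfolding none by simp
  qed
  show ?case
  proof (cases "z \<in> {x, y}")
    case True
    then have "z \<notin> {\<phi> c, \<phi> d} \<union> new_verts B'"
      using ladder_verts[OF B'] rungsD(3-5)[OF \<phi>] Suc.prems(2,3) by blast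
    then show ?thesis using le r l0 True by simp
  next
    case False
    show ?thesis
    proof (cases "z \<in> {\<phi> c, \<phi> d}")
      case True
      then show ?thesis using le r IH False by simp
    next
      case z: False
      show ?thesis
      proof (cases "z \<in> new_verts B'")
        case True
        then have "z \<notin> {x, y} \<union> \<phi> ` U"
          using ladder_verts[OF B'] Suc.prems(2,3) by blast
        then show ?thesis using le r0 IH False z by simp
      next
        case notin: False
        then have "card ?l = 0" using z by (intro l0) simp
        then show ?thesis using le r False by simp
      qed
    qed
  qed
qed

lemma ladder_degree:
  assumes "B \<in> ladders n L F" "x \<in> F" "y \<in> F" "x \<noteq> y"
  shows "card {e \<in> ladder_edges B x y. z \<in> e} \<le> 2 * card R + 1"
  using ladder_degree_aux[OF assms, of z] by (auto split: if_splits)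

end

text \<open>
The vertices at distance at most \<open>j\<close> from \<open>T\<close> in the graph with edge set \<open>A\<close>.
\<close>

primrec edge_ball :: "'v set set \<Rightarrow> 'v set \<Rightarrow> nat \<Rightarrow> 'v set" where
  "edge_ball A T 0 = T"
| "edge_ball A T (Suc j) = (\<Union>z\<in>edge_ball A T j. insert z (\<Union>{e \<in> A. z \<in> e}))"

lemma edge_ball_card:
  assumes "finite A" "\<And>e. e \<in> A \<Longrightarrow> card e = 2" "\<And>z. card {e \<in> A. z \<in> e} \<le> \<Delta>" "finite T"
  shows "finite (edge_ball A T j) \<and> card (edge_ball A T j) \<le> card T * (1 + 2 * \<Delta>) ^ j"
proof (induction j)
  case (Suc j)
  have fin: "finite e" if "e \<in> A" for e using assms(2)[OF that] by (simp add: card_ge_0_finite)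
  have fu: "finite (insert z (\<Union>{e \<in> A. z \<in> e}))" for z using assms(1) fin by auto
  have "card (insert z (\<Union>{e \<in> A. z \<in> e})) \<le> 1 + 2 * \<Delta>" for z
  proof -
    have "card (\<Union>{e \<in> A. z \<in> e}) \<le> (\<Sum>e\<in>{e \<in> A. z \<in> e}. card e)"
      by (rule card_Union_le_sum_card)
    also have "\<dots> = 2 * card {e \<in> A. z \<in> e}" using assms(2) by simp
    also have "\<dots> \<le> 2 * \<Delta>" using assms(3) by simp
    finally show ?thesis using card_insert_le_m1[of "1 + 2 * \<Delta>" "\<Union>{e \<in> A. z \<in> e}" z] by simp
  qed
  then have "card (edge_ball A T (Suc j)) \<le> (\<Sum>z\<in>edge_ball A T j. 1 + 2 * \<Delta>)"
    using Suc unfolding edge_ball.simps by (intro order.trans[OF card_UN_le] sum_mono) auto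
  also have "\<dots> = card (edge_ball A T j) * (1 + 2 * \<Delta>)" by simp
  also have "\<dots> \<le> (card T * (1 + 2 * \<Delta>) ^ j) * (1 + 2 * \<Delta>)"
    using Suc by (intro mult_right_mono) auto
  finally have "card (edge_ball A T (Suc j)) \<le> card T * (1 + 2 * \<Delta>) ^ Suc j" by (simp only: power_Suc ac_simps)
  then show ?case using Suc fu by simp
qed (simp add: assms(4))

context balanced_rung begin

definition absorbed_bound :: nat where
  "absorbed_bound = (2 * (1 + 2 * (2 * card R + 1)) ^ card V) ^ card U"

text \<open>
This is the bound on the number of fully overlapping rungs. Every vertex of a rung is connected to the base
pair within the rung, so if the rung lies in \<open>A\<close>, all its vertices lie in a ball of bounded radius around
\<open>xy\<close>, and bounded degrees bound the size of that ball independently of the size of \<open>A\<close>.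
\<close>

lemma card_absorbed_rungs:
  assumes A: "finite A" "A \<subseteq> pairs_of W" and deg: "\<And>z. card {e \<in> A. z \<in> e} \<le> 2 * card R + 1"
    and xy: "x \<noteq> y"
  shows "card {\<phi> \<in> rungs n {x, y}. rung_edges x y \<phi> \<subseteq> A} \<le> absorbed_bound"
proof -
  define N where "N = edge_ball A {x, y}"
  have A2: "card e = 2" if "e \<in> A" for e using A(2) that by (auto simp: pairs_of_def)
  have c2: "card {x, y} = 2" using xy by simp
  have N: "finite (N j)" "card (N j) \<le> 2 * (1 + 2 * (2 * card R + 1)) ^ j" for j
    using edge_ball_card[OF A(1) A2 deg, of "{x, y}" j] unfolding N_def c2 by blast+
  have "{\<phi> \<in> rungs n {x, y}. rung_edges x y \<phi> \<subseteq> A} \<subseteq> U \<rightarrow>\<^sub>E N (card V)"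
  proof
    fix \<phi> assume "\<phi> \<in> {\<phi> \<in> rungs n {x, y}. rung_edges x y \<phi> \<subseteq> A}"
    then have \<phi>: "\<phi> \<in> rungs n {x, y}" and sub: "rung_edges x y \<phi> \<subseteq> A" by auto
    define W where "W j = {u \<in> V. place x y \<phi> u \<in> N j}" for j
    have WV: "W j \<subseteq> V" for j by (auto simp: W_def)
    have finW: "finite (W j)" for j using WV finV finite_subset by blast
    have mono: "W j \<subseteq> W (Suc j)" for j by (auto simp: W_def N_def)
    have abW: "{a, b} \<subseteq> W j" for j
    proof (induction j)
      case 0
      show ?case using ab by (simp add: W_def N_def)
    next
      case (Suc j)
      then show ?case using mono by blast
    qed
    have grow: "W j = V \<or> j + 2 \<le> card (W j)" for j
    proof (induction j)
      case 0
      then show ?case using card_mono[OF finW abW] ab by simp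
    next
      case (Suc j)
      show ?case
      proof (cases "W j = V")
        case True
        then show ?thesis using mono[of j] WV[of "Suc j"] by blast
      next
        case False
        then have "W j \<subset> V" using WV by blast
        then obtain e where e: "e \<in> R" "e \<inter> W j \<noteq> {}" "e - W j \<noteq> {}"
          using rung_connected[OF abW] by blast
        then obtain u w where u: "u \<in> e" "u \<in> W j" and w: "w \<in> e" "w \<notin> W j" by blast
        have "place x y \<phi> ` e \<in> A" using sub e(1) by (auto simp: rung_edges_def)
        moreover have "place x y \<phi> u \<in> N j" using u(2) by (simp add: W_def)
        ultimately have "place x y \<phi> w \<in> N (Suc j)" using u(1) w(1) by (auto simp: N_def)
        moreover have "w \<in> V" using e(1) w(1) R_pairs by (auto simp: pairs_of_def)
        ultimately have "w \<in> W (Suc j)" by (simp add: W_def)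
        then have "insert w (W j) \<subseteq> W (Suc j)" using mono by blast
        then have "card (insert w (W j)) \<le> card (W (Suc j))" by (rule card_mono[OF finW])
        then show ?thesis using Suc False w(2) finW by simp
      qed
    qed
    have "W (card V) = V"
      using grow[of "card V"] card_mono[OF finV WV, of "card V"] by linarith
    then have "\<phi> u \<in> N (card V)" if "u \<in> U" for u
    proof -
      have "u \<in> W (card V)" using that \<open>W (card V) = V\<close> by (simp add: U_def)
      then show ?thesis using that by (simp add: W_def)
    qed
    then show "\<phi> \<in> U \<rightarrow>\<^sub>E N (card V)" using \<phi> by (auto simp: rungs_def PiE_def)
  qed
  then have "card {\<phi> \<in> rungs n {x, y}. rung_edges x y \<phi> \<subseteq> A} \<le> card (U \<rightarrow>\<^sub>E N (card V))"
    using finU N(1) by (intro card_mono finite_PiE) auto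
  also have "\<dots> = card (N (card V)) ^ card U" using finU by (simp add: card_PiE)
  also have "\<dots> \<le> absorbed_bound" unfolding absorbed_bound_def by (rule power_mono[OF N(2)]) simp
  finally show ?thesis .
qed

end

section \<open>Overlaps of two ladders\<close>

context balanced_rung begin

text \<open>
The total weight \<open>p ^ |B - A|\<close> of all ladders \<open>B\<close>, organised rung by rung so that it can be bounded by
recursion. Each rung is only required to avoid its own base pair, which enlarges the sum and
keeps the recursion free of the history.
\<close>

primrec overlap_sum :: "nat \<Rightarrow> real \<Rightarrow> nat set set \<Rightarrow> nat \<Rightarrow> nat \<Rightarrow> nat \<Rightarrow> real" where
  "overlap_sum n p A 0 x y = (if {x, y} \<in> A then 1 else p)"
| "overlap_sum n p A (Suc L) x y =
    (\<Sum>\<phi>\<in>rungs n {x, y}. p ^ card (rung_edges x y \<phi> - A) * overlap_sum n p A L (\<phi> c) (\<phi> d))"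

lemma overlap_sum_nonneg: "0 \<le> p \<Longrightarrow> 0 \<le> overlap_sum n p A L x y"
  by (induction L arbitrary: x y) (auto intro!: sum_nonneg mult_nonneg_nonneg)

lemma sum_ladders_le_overlap_sum:
  assumes "0 \<le> p" "x \<in> F" "y \<in> F" "x \<noteq> y"
  shows "(\<Sum>B\<in>ladders n L F. p ^ card (ladder_edges B x y - A)) \<le> overlap_sum n p A L x y"
  using assms(2-)
proof (induction L arbitrary: F x y)
  case 0
  have "{{x, y}} - A = (if {x, y} \<in> A then {} else {{x, y}})" by auto
  then show ?case by simp
next
  case (Suc L)
  have split: "(\<Sum>B\<in>ladders n L (F \<union> \<phi> ` U). p ^ card (ladder_edges (\<phi> # B) x y - A))
      \<le> p ^ card (rung_edges x y \<phi> - A) * overlap_sum n p A L (\<phi> c) (\<phi> d)"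
    if \<phi>: "\<phi> \<in> rungs n F" for \<phi>
  proof -
    have card_eq: "card (ladder_edges (\<phi> # B) x y - A)
        = card (rung_edges x y \<phi> - A) + card (ladder_edges B (\<phi> c) (\<phi> d) - A)"
      if B: "B \<in> ladders n L (F \<union> \<phi> ` U)" for B
    proof -
      have "ladder_edges (\<phi> # B) x y - A = (rung_edges x y \<phi> - A) \<union> (ladder_edges B (\<phi> c) (\<phi> d) - A)"
        by auto
      then show ?thesis
        using rung_edges_disjoint[OF \<phi> B Suc.prems]
        by (simp only:) (rule card_Un_disjoint, auto simp: finite_rung_edges finite_ladder_edges)
    qed
    have "(\<Sum>B\<in>ladders n L (F \<union> \<phi> ` U). p ^ card (ladder_edges (\<phi> # B) x y - A))
        = (\<Sum>B\<in>ladders n L (F \<union> \<phi> ` U). p ^ card (rung_edges x y \<phi> - A) * p ^ card (ladder_edges B (\<phi> c) (\<phi> d) - A))"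
      by (rule sum.cong[OF refl]) (simp only: card_eq power_add)
    also have "\<dots> = p ^ card (rung_edges x y \<phi> - A) * (\<Sum>B\<in>ladders n L (F \<union> \<phi> ` U). p ^ card (ladder_edges B (\<phi> c) (\<phi> d) - A))"
      by (simp only: sum_distrib_left)
    also have "\<dots> \<le> p ^ card (rung_edges x y \<phi> - A) * overlap_sum n p A L (\<phi> c) (\<phi> d)"
      using assms(1) rungsD[OF \<phi>] by (intro mult_left_mono Suc.IH) auto
    finally show ?thesis .
  qed
  have "(\<Sum>B\<in>ladders n (Suc L) F. p ^ card (ladder_edges B x y - A))
      \<le> (\<Sum>\<phi>\<in>rungs n F. p ^ card (rung_edges x y \<phi> - A) * overlap_sum n p A L (\<phi> c) (\<phi> d))"
    unfolding sum_ladders_Suc by (rule sum_mono[OF split])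
  also have "\<dots> \<le> overlap_sum n p A (Suc L) x y"
    unfolding overlap_sum.simps using assms(1) Suc.prems
    by (intro sum_mono2 finite_rungs rungs_antimono) (auto intro!: overlap_sum_nonneg mult_nonneg_nonneg)
  finally show ?case .
qed

text \<open>
The vertices of a rung that fall into \<open>W\<close>, split into new ones (\<open>hits\<close>) and base ones (\<open>base_hits\<close>). The
sum over all rungs is grouped by \<open>hits\<close>.
\<close>

definition hits :: "nat set \<Rightarrow> ('a \<Rightarrow> nat) \<Rightarrow> 'a set" where
  "hits W \<phi> = {u \<in> U. \<phi> u \<in> W}"

definition base_hits :: "nat set \<Rightarrow> nat \<Rightarrow> nat \<Rightarrow> 'a set" where
  "base_hits W x y = (if x \<in> W then {a} else {}) \<union> (if y \<in> W then {b} else {})"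

lemma base_hits_subset: "base_hits W x y \<subseteq> {a, b}" by (auto simp: base_hits_def)

lemma base_hits_eq: "base_hits W x y = {a, b} \<longleftrightarrow> {x, y} \<subseteq> W"
  using ab by (auto simp: base_hits_def)

lemma e_in_mono: "S \<subseteq> T \<Longrightarrow> e_in S \<le> e_in T"
  unfolding e_in_def using finR by (intro card_mono) auto

lemma e_in_le: "e_in T \<le> card R"
  unfolding e_in_def using finR by (intro card_mono) auto

lemma card_hits_fibre:
  assumes "S \<subseteq> U" "finite W" "card W \<le> m"
  shows "card {\<phi> \<in> rungs n F. hits W \<phi> = S} \<le> m ^ card S * n ^ (card U - card S)"
proof -
  let ?B = "\<lambda>u. if u \<in> S then W else {1..n}"
  have finS: "finite S" using assms(1) finU finite_subset by blast
  have "{\<phi> \<in> rungs n F. hits W \<phi> = S} \<subseteq> PiE U ?B"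
    unfolding rungs_def hits_def PiE_def Pi_def by auto
  then have "card {\<phi> \<in> rungs n F. hits W \<phi> = S} \<le> card (PiE U ?B)"
    using finU assms(2) by (intro card_mono finite_PiE) auto
  also have "\<dots> = (\<Prod>u\<in>U. if u \<in> S then card W else n)"
    using finU by (subst card_PiE) (auto intro!: prod.cong)
  also have "\<dots> = card W ^ card S * n ^ card (U - S)"
    using finU assms(1) by (subst prod.If_cases) (simp_all add: Int_absorb1 Diff_eq)
  also have "card (U - S) = card U - card S" using assms(1) finS by (rule card_Diff_subset[rotated])
  also have "card W ^ card S * n ^ (card U - card S) \<le> m ^ card S * n ^ (card U - card S)"
    using assms(3) by (intro mult_right_mono power_mono) auto
  finally show ?thesis .
qed

lemma card_rung_edges_diff_ge:
  assumes "\<phi> \<in> rungs n {x, y}" "x \<noteq> y" "A \<subseteq> Pow W"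
  shows "card R - e_in (hits W \<phi> \<union> base_hits W x y) \<le> card (rung_edges x y \<phi> - A)"
proof -
  let ?T = "hits W \<phi> \<union> base_hits W x y"
  have "rung_edges x y \<phi> \<inter> A \<subseteq> (\<lambda>e. place x y \<phi> ` e) ` {e \<in> R. e \<subseteq> ?T}"
  proof
    fix f assume f: "f \<in> rung_edges x y \<phi> \<inter> A"
    then obtain e where e: "e \<in> R" "f = place x y \<phi> ` e" by (auto simp: rung_edges_def)
    have "e \<subseteq> ?T"
    proof
      fix u assume u: "u \<in> e"
      then have "place x y \<phi> u \<in> W" using e f assms(3) by blast
      moreover have "u \<in> V" using u e R_pairs by (auto simp: pairs_of_def)
      ultimately show "u \<in> ?T" unfolding in_V_iff by (auto simp: hits_def base_hits_def)
    qed
    then show "f \<in> (\<lambda>e. place x y \<phi> ` e) ` {e \<in> R. e \<subseteq> ?T}" using e by blast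
  qed
  then have "card (rung_edges x y \<phi> \<inter> A) \<le> card ((\<lambda>e. place x y \<phi> ` e) ` {e \<in> R. e \<subseteq> ?T})"
    using finR by (intro card_mono) auto
  also have "\<dots> \<le> e_in ?T" unfolding e_in_def using finR by (intro card_image_le) auto
  finally have "card (rung_edges x y \<phi> \<inter> A) \<le> e_in ?T" .
  moreover have "card (rung_edges x y \<phi>) = card R"
    by (rule card_rung_edges[OF assms(1)]) (use assms(2) in auto)
  moreover have "card (rung_edges x y \<phi>) = card (rung_edges x y \<phi> - A) + card (rung_edges x y \<phi> \<inter> A)"
    using card_Diff_subset_Int[of "rung_edges x y \<phi>" A] card_mono[OF finite_rung_edges, of "rung_edges x y \<phi> \<inter> A" x y \<phi>]
    by (simp add: finite_rung_edges)
  ultimately show ?thesis by linarith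
qed

end

text \<open>
The situation of the second moment computation: \<open>A\<close> is the edge set and \<open>W\<close> the vertex set of the ladder that
is kept fixed, \<open>\<nu>\<close> is the expected number of rungs on a given base pair, and \<open>\<kappa>\<close> is the relative weight of the
rungs that lie entirely in \<open>A\<close>.
\<close>

locale ladder_overlap = balanced_rung +
  fixes n m :: nat and p \<gamma> \<kappa> \<nu> :: real and A :: "nat set set" and W :: "nat set"
  assumes n1: "1 \<le> n" and m1: "1 \<le> m" and p0: "0 < p" and p1: "p \<le> 1"
    and p_ge: "real n powr (- 1 / lm) \<le> p"
    and AW: "A \<subseteq> Pow W" and finW: "finite W" and cardW: "card W \<le> m"
    and gap: "\<And>S. S \<subseteq> U \<Longrightarrow> S \<noteq> {} \<Longrightarrow> S \<noteq> U \<Longrightarrow> real (e_in (S \<union> {a, b})) \<le> lm * (real (card S) - \<gamma>)"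
    and nu_def: "\<nu> = real n ^ card U * p ^ card R"
    and absorbed: "\<And>x y. x \<noteq> y \<Longrightarrow> real (card {\<phi> \<in> rungs n {x, y}. rung_edges x y \<phi> \<subseteq> A}) \<le> \<kappa> * \<nu>"
    and p_small: "p \<le> \<nu> * real n powr (- \<gamma>)"
begin

text \<open>
Relative weights of the rungs that overlap \<open>W\<close> without being absorbed (\<open>\<eta>\<close>), and of those that start
outside \<open>W\<close> and exit inside (\<open>\<zeta>\<close>).
\<close>

definition \<eta> :: real where "\<eta> = (2 ^ card U + 1) * (real m ^ card U * real n powr (- \<gamma>))"
definition \<zeta> :: real where "\<zeta> = 2 ^ card U * (real m ^ card U / real n)"

lemma nu_pos: "0 < \<nu>" using n1 p0 by (simp add: nu_def)

lemma eta_nonneg: "0 \<le> \<eta>" and zeta_nonneg: "0 \<le> \<zeta>" by (simp_all add: \<eta>_def \<zeta>_def)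

text \<open>
The edges that are shared are paid for by the vertices that are fixed: since \<open>1/p\<close> is at most \<open>n^(1/\<lambda>)\<close>,
saving \<open>e\<close> edges while fixing \<open>|S|\<close> vertices changes the weight by at most \<open>n^(e/\<lambda> - |S|)\<close>, apart from
the number of ways to choose the fixed vertices.
\<close>

lemma fibre_weight:
  assumes S: "S \<subseteq> U" and e: "real e \<le> lm * (real (card S) - \<delta>)" "e \<le> card R"
  shows "real (m ^ card S * n ^ (card U - card S)) * p ^ (card R - e) \<le> \<nu> * (real m ^ card U * real n powr (- \<delta>))"
proof -
  have cS: "card S \<le> card U" using S finU by (rule card_mono[rotated])
  have n0: "real n > 0" using n1 by simp
  have "1 / p \<le> real n powr (1 / lm)"
  proof -
    have "1 = real n powr (- 1 / lm) * real n powr (1 / lm)"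
      using n0 by (simp add: powr_add[symmetric])
    also have "\<dots> \<le> p * real n powr (1 / lm)" using p_ge by (intro mult_right_mono) auto
    finally show ?thesis using p0 by (simp add: field_simps)
  qed
  then have "(1 / p) ^ e \<le> (real n powr (1 / lm)) ^ e" using p0 by (intro power_mono) auto
  also have "\<dots> = real n powr (real e / lm)" using n0 by (simp add: powr_power)
  also have "\<dots> \<le> real n powr (real (card S) - \<delta>)"
    using n1 e(1) lm1 by (intro powr_mono) (auto simp: field_simps)
  also have "\<dots> = real n ^ card S * real n powr (- \<delta>)"
    using n0 by (simp add: powr_add[symmetric] powr_realpow[symmetric])
  finally have inv: "(1 / p) ^ e \<le> real n ^ card S * real n powr (- \<delta>)" .
  have ms: "real m ^ card S \<le> real m ^ card U" using m1 cS by (intro power_increasing) auto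
  have "p ^ (card R - e) = p ^ card R * (1 / p) ^ e"
    using p0 e(2) by (simp add: power_diff power_one_over)
  then have "real (m ^ card S * n ^ (card U - card S)) * p ^ (card R - e)
      = real m ^ card S * (real n ^ (card U - card S) * p ^ card R) * (1 / p) ^ e"
    by simp
  also have "\<dots> \<le> real m ^ card U * (real n ^ (card U - card S) * p ^ card R) * (real n ^ card S * real n powr (- \<delta>))"
    using p0 ms inv by (intro mult_mono) auto
  also have "\<dots> = real m ^ card U * (real n ^ (card U - card S) * real n ^ card S) * p ^ card R * real n powr (- \<delta>)"
    by simp
  also have "real n ^ (card U - card S) * real n ^ card S = real n ^ card U"
    using cS by (simp add: power_add[symmetric])
  finally show ?thesis by (simp add: nu_def mult_ac)
qed

lemma fibre_sum:
  assumes xy: "x \<noteq> y" and S: "S \<subseteq> U" and t: "0 \<le> t"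
    and g: "\<And>\<phi>. \<phi> \<in> rungs n {x, y} \<Longrightarrow> hits W \<phi> = S \<Longrightarrow> g \<phi> \<le> t"
  shows "(\<Sum>\<phi> | \<phi> \<in> rungs n {x, y} \<and> hits W \<phi> = S. p ^ card (rung_edges x y \<phi> - A) * g \<phi>)
    \<le> real (m ^ card S * n ^ (card U - card S)) * p ^ (card R - e_in (S \<union> base_hits W x y)) * t"
proof -
  let ?w = "p ^ (card R - e_in (S \<union> base_hits W x y))"
  have "(\<Sum>\<phi> | \<phi> \<in> rungs n {x, y} \<and> hits W \<phi> = S. p ^ card (rung_edges x y \<phi> - A) * g \<phi>)
      \<le> (\<Sum>\<phi> | \<phi> \<in> rungs n {x, y} \<and> hits W \<phi> = S. ?w * t)"
  proof (rule sum_mono)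
    fix \<phi> assume "\<phi> \<in> {\<phi>. \<phi> \<in> rungs n {x, y} \<and> hits W \<phi> = S}"
    then have \<phi>: "\<phi> \<in> rungs n {x, y}" "hits W \<phi> = S" by auto
    have "p ^ card (rung_edges x y \<phi> - A) \<le> ?w"
      using card_rung_edges_diff_ge[OF \<phi>(1) xy AW] \<phi>(2) p0 p1 by (intro power_decreasing) auto
    then show "p ^ card (rung_edges x y \<phi> - A) * g \<phi> \<le> ?w * t"
      using g[OF \<phi>] t p0 by (intro order.trans[OF mult_left_mono mult_right_mono]) auto
  qed
  also have "\<dots> = real (card {\<phi> \<in> rungs n {x, y}. hits W \<phi> = S}) * (?w * t)" by simp
  also have "\<dots> \<le> real (m ^ card S * n ^ (card U - card S)) * (?w * t)"
    using card_hits_fibre[OF S finW cardW, of n "{x, y}"] p0 t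
    by (intro mult_right_mono of_nat_mono) auto
  finally show ?thesis by (simp only: mult.assoc)
qed

lemma sum_by_hits:
  "(\<Sum>\<phi>\<in>rungs n {x, y}. f \<phi>) = (\<Sum>S\<in>Pow U. \<Sum>\<phi> | \<phi> \<in> rungs n {x, y} \<and> hits W \<phi> = S. f \<phi>)"
  by (rule sum.group[symmetric]) (auto simp: finite_rungs finU hits_def)

lemma fibre_no_hits:
  assumes xy: "x \<noteq> y" and s: "0 \<le> s"
    and g: "\<And>\<phi>. \<phi> \<in> rungs n {x, y} \<Longrightarrow> hits W \<phi> = {} \<Longrightarrow> g \<phi> \<le> s"
  shows "(\<Sum>\<phi> | \<phi> \<in> rungs n {x, y} \<and> hits W \<phi> = {}. p ^ card (rung_edges x y \<phi> - A) * g \<phi>) \<le> \<nu> * s"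
proof -
  have "(\<Sum>\<phi> | \<phi> \<in> rungs n {x, y} \<and> hits W \<phi> = {}. p ^ card (rung_edges x y \<phi> - A) * g \<phi>)
    \<le> real (m ^ card ({} :: 'a set) * n ^ (card U - card ({} :: 'a set))) * p ^ (card R - e_in ({} \<union> base_hits W x y)) * s"
    by (rule fibre_sum) (use assms in auto)
  also have "e_in ({} \<union> base_hits W x y) = 0"
    by (rule e_in_no_new) (use base_hits_subset in simp)
  finally show ?thesis by (simp add: nu_def)
qed

lemma fibre_partial:
  assumes xy: "x \<noteq> y" and S: "S \<subseteq> U" "S \<noteq> {}" "S \<noteq> U" and t: "0 \<le> t"
    and g: "\<And>\<phi>. \<phi> \<in> rungs n {x, y} \<Longrightarrow> hits W \<phi> = S \<Longrightarrow> g \<phi> \<le> t"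
  shows "(\<Sum>\<phi> | \<phi> \<in> rungs n {x, y} \<and> hits W \<phi> = S. p ^ card (rung_edges x y \<phi> - A) * g \<phi>)
    \<le> \<nu> * (real m ^ card U * real n powr (- \<gamma>) * t)"
proof -
  have le: "real (e_in (S \<union> base_hits W x y)) \<le> lm * (real (card S) - \<gamma>)"
    using gap[OF S] e_in_mono[of "S \<union> base_hits W x y" "S \<union> {a, b}"] base_hits_subset[of W x y] by fastforce
  have "(\<Sum>\<phi> | \<phi> \<in> rungs n {x, y} \<and> hits W \<phi> = S. p ^ card (rung_edges x y \<phi> - A) * g \<phi>)
      \<le> real (m ^ card S * n ^ (card U - card S)) * p ^ (card R - e_in (S \<union> base_hits W x y)) * t"
    by (rule fibre_sum[OF xy S(1) t g])
  also have "\<dots> \<le> \<nu> * (real m ^ card U * real n powr (- \<gamma>)) * t"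
    by (rule mult_right_mono[OF fibre_weight[OF S(1) le e_in_le] t])
  finally show ?thesis by (simp only: mult.assoc)
qed

lemma fibre_exit:
  assumes xy: "x \<noteq> y" "\<not> {x, y} \<subseteq> W" and S: "S \<subseteq> U" "c \<in> S" "d \<in> S" and t: "0 \<le> t"
    and g: "\<And>\<phi>. \<phi> \<in> rungs n {x, y} \<Longrightarrow> hits W \<phi> = S \<Longrightarrow> g \<phi> \<le> t"
  shows "(\<Sum>\<phi> | \<phi> \<in> rungs n {x, y} \<and> hits W \<phi> = S. p ^ card (rung_edges x y \<phi> - A) * g \<phi>)
    \<le> \<nu> * (real m ^ card U / real n * t)"
proof -
  have le: "real (e_in (S \<union> base_hits W x y)) \<le> lm * (real (card S) - 1)"
    using e_in_with_exit[OF S base_hits_subset] base_hits_eq[of W x y] xy(2) by simp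
  have "(\<Sum>\<phi> | \<phi> \<in> rungs n {x, y} \<and> hits W \<phi> = S. p ^ card (rung_edges x y \<phi> - A) * g \<phi>)
      \<le> real (m ^ card S * n ^ (card U - card S)) * p ^ (card R - e_in (S \<union> base_hits W x y)) * t"
    by (rule fibre_sum[OF xy(1) S(1) t g])
  also have "\<dots> \<le> \<nu> * (real m ^ card U * real n powr (- 1)) * t"
    by (rule mult_right_mono[OF fibre_weight[OF S(1) le e_in_le] t])
  also have "real n powr (- 1) = 1 / real n" using n1 by (simp add: powr_minus_divide)
  finally show ?thesis by (simp add: mult.assoc)
qed

text \<open>
The rungs with all new vertices in \<open>W\<close>. The absorbed ones are counted by \<open>\<kappa> \<nu>\<close>; any other one has at
least one edge outside \<open>A\<close>, and the resulting factor \<open>p\<close> already suffices against their trivial number.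
\<close>

lemma fibre_full:
  assumes xy: "x \<noteq> y" and t: "0 \<le> t"
    and g: "\<And>\<phi>. \<phi> \<in> rungs n {x, y} \<Longrightarrow> g \<phi> \<le> t"
  shows "(\<Sum>\<phi> | \<phi> \<in> rungs n {x, y} \<and> hits W \<phi> = U. p ^ card (rung_edges x y \<phi> - A) * g \<phi>)
    \<le> \<nu> * ((\<kappa> + real m ^ card U * real n powr (- \<gamma>)) * t)"
proof -
  let ?X = "{\<phi>. \<phi> \<in> rungs n {x, y} \<and> hits W \<phi> = U}"
  let ?ab = "\<lambda>\<phi>. rung_edges x y \<phi> \<subseteq> A"
  have finX: "finite ?X" using finite_rungs[of n "{x, y}"] by simp
  have "(\<Sum>\<phi>\<in>?X. p ^ card (rung_edges x y \<phi> - A) * g \<phi>) \<le> (\<Sum>\<phi>\<in>?X. ((if ?ab \<phi> then 1 else 0) + p) * t)"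
  proof (rule sum_mono)
    fix \<phi> assume \<phi>: "\<phi> \<in> ?X"
    have "p ^ card (rung_edges x y \<phi> - A) \<le> (if ?ab \<phi> then 1 else 0) + p"
    proof (cases "?ab \<phi>")
      case True
      then have none: "rung_edges x y \<phi> - A = {}" by blast
      show ?thesis unfolding none using p0 True by simp
    next
      case False
      then have "rung_edges x y \<phi> - A \<noteq> {}" by blast
      then have "1 \<le> card (rung_edges x y \<phi> - A)"
        using finite_rung_edges by (simp add: Suc_leI card_gt_0_iff)
      then have "p ^ card (rung_edges x y \<phi> - A) \<le> p ^ 1" using p0 p1 by (intro power_decreasing) auto
      then show ?thesis using False by simp
    qed
    then show "p ^ card (rung_edges x y \<phi> - A) * g \<phi> \<le> ((if ?ab \<phi> then 1 else 0) + p) * t"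
      using g[of \<phi>] \<phi> t p0 by (intro order.trans[OF mult_left_mono mult_right_mono]) auto
  qed
  also have "\<dots> = ((\<Sum>\<phi>\<in>?X. if ?ab \<phi> then 1 else 0) + real (card ?X) * p) * t"
    by (simp add: sum_distrib_right[symmetric] sum.distrib)
  also have "(\<Sum>\<phi>\<in>?X. if ?ab \<phi> then 1 else 0 :: real) = real (card {\<phi> \<in> ?X. ?ab \<phi>})"
    using finX by (subst sum.inter_filter[symmetric]) auto
  also have "(real (card {\<phi> \<in> ?X. ?ab \<phi>}) + real (card ?X) * p) * t
      \<le> (\<kappa> * \<nu> + real m ^ card U * (\<nu> * real n powr (- \<gamma>))) * t"
  proof (intro mult_right_mono add_mono mult_mono t)
    have "card {\<phi> \<in> ?X. ?ab \<phi>} \<le> card {\<phi> \<in> rungs n {x, y}. ?ab \<phi>}"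
      using finite_rungs[of n "{x, y}"] by (intro card_mono) auto
    then show "real (card {\<phi> \<in> ?X. ?ab \<phi>}) \<le> \<kappa> * \<nu>" using absorbed[OF xy] by linarith
    have "card ?X \<le> m ^ card U" using card_hits_fibre[OF subset_refl finW cardW, of n "{x, y}"] by simp
    then show "real (card ?X) \<le> real m ^ card U" using of_nat_mono by fastforce
  qed (use p_small p0 in auto)
  also have "\<dots> = \<nu> * ((\<kappa> + real m ^ card U * real n powr (- \<gamma>)) * t)" by (simp add: algebra_simps)
  finally show ?thesis .
qed

text \<open>
One step of the recursion when the base pair is not contained in \<open>W\<close>. Here \<open>s\<close> and \<open>t\<close> bound what
follows a rung that exits outside \<open>W\<close> and an arbitrary rung. A rung without hits exits outside and contributes
the main term; absorption is impossible, and an exit inside \<open>W\<close> has only weight \<open>\<zeta>\<close>.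
\<close>

lemma rung_step_outside:
  assumes xy: "x \<noteq> y" "\<not> {x, y} \<subseteq> W" and st: "0 \<le> s" "s \<le> t"
    and gt: "\<And>\<phi>. \<phi> \<in> rungs n {x, y} \<Longrightarrow> g \<phi> \<le> t"
    and gs: "\<And>\<phi>. \<phi> \<in> rungs n {x, y} \<Longrightarrow> \<not> {\<phi> c, \<phi> d} \<subseteq> W \<Longrightarrow> g \<phi> \<le> s"
  shows "(\<Sum>\<phi>\<in>rungs n {x, y}. p ^ card (rung_edges x y \<phi> - A) * g \<phi>) \<le> \<nu> * ((1 + \<eta>) * s + \<zeta> * t)"
proof -
  let ?q = "real m ^ card U * real n powr (- \<gamma>)" and ?r = "real m ^ card U / real n"
  have q0: "0 \<le> ?q" "0 \<le> ?r" by simp_all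
  have t0: "0 \<le> t" using st by simp
  have fibre: "(\<Sum>\<phi> | \<phi> \<in> rungs n {x, y} \<and> hits W \<phi> = S. p ^ card (rung_edges x y \<phi> - A) * g \<phi>)
      \<le> \<nu> * ((if S = {} then s else 0) + (?q * s + ?r * t))" (is "?l \<le> _") if "S \<in> Pow U" for S
  proof -
    have SU: "S \<subseteq> U" using that by simp
    have gs': "g \<phi> \<le> s" if "\<phi> \<in> rungs n {x, y}" "hits W \<phi> = S" "\<not> (c \<in> S \<and> d \<in> S)" for \<phi>
      using gs[OF that(1)] that(2,3) cdU by (auto simp: hits_def)
    consider "S = {}" | "c \<in> S" "d \<in> S" | "S \<noteq> {}" "\<not> (c \<in> S \<and> d \<in> S)" by blast
    then show ?thesis
    proof cases
      case 1
      then have "?l \<le> \<nu> * s" using fibre_no_hits[of x y s g] xy(1) st(1) gs' by auto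
      also have "\<dots> \<le> \<nu> * (s + (?q * s + ?r * t))"
        using nu_pos q0 st t0 by (intro mult_left_mono) auto
      finally show ?thesis using 1 by simp
    next
      case 2
      have "?l \<le> \<nu> * (?r * t)" by (rule fibre_exit) (use xy SU 2 t0 gt in auto)
      also have "\<dots> \<le> \<nu> * (0 + (?q * s + ?r * t))"
        using nu_pos q0 st t0 by (intro mult_left_mono) auto
      finally show ?thesis using 2 by auto
    next
      case 3
      then have "S \<noteq> U" using cdU by auto
      then have "?l \<le> \<nu> * (?q * s)"
        by (intro fibre_partial) (use xy SU 3 st gs' in auto)
      also have "\<dots> \<le> \<nu> * (0 + (?q * s + ?r * t))"
        using nu_pos q0 st t0 by (intro mult_left_mono) auto
      finally show ?thesis using 3 by simp
    qed
  qed
  have "(\<Sum>\<phi>\<in>rungs n {x, y}. p ^ card (rung_edges x y \<phi> - A) * g \<phi>)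
      \<le> (\<Sum>S\<in>Pow U. \<nu> * ((if S = {} then s else 0) + (?q * s + ?r * t)))"
    unfolding sum_by_hits by (rule sum_mono[OF fibre])
  also have "\<dots> = \<nu> * (s + 2 ^ card U * (?q * s + ?r * t))"
    using finU by (simp add: sum_distrib_left[symmetric] sum.distrib card_Pow)
  also have "\<dots> \<le> \<nu> * ((1 + \<eta>) * s + \<zeta> * t)"
  proof (intro mult_left_mono)
    have "(1 + \<eta>) * s + \<zeta> * t = s + 2 ^ card U * (?q * s + ?r * t) + ?q * s"
      unfolding \<eta>_def \<zeta>_def by (simp add: algebra_simps)
    then show "s + 2 ^ card U * (?q * s + ?r * t) \<le> (1 + \<eta>) * s + \<zeta> * t"
      using mult_nonneg_nonneg[OF q0(1) st(1)] by linarith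
  qed (use nu_pos in simp)
  finally show ?thesis .
qed

text \<open>
One step of the recursion when the base pair may lie in \<open>W\<close>: either the rung leaves \<open>W\<close> completely, with
the main weight, or it stays in touch with it, with the small weight \<open>\<kappa> + \<eta>\<close>.
\<close>

lemma rung_step_inside:
  assumes xy: "x \<noteq> y" and st: "0 \<le> s" "s \<le> t"
    and gt: "\<And>\<phi>. \<phi> \<in> rungs n {x, y} \<Longrightarrow> g \<phi> \<le> t"
    and gs: "\<And>\<phi>. \<phi> \<in> rungs n {x, y} \<Longrightarrow> \<not> {\<phi> c, \<phi> d} \<subseteq> W \<Longrightarrow> g \<phi> \<le> s"
  shows "(\<Sum>\<phi>\<in>rungs n {x, y}. p ^ card (rung_edges x y \<phi> - A) * g \<phi>) \<le> \<nu> * (s + (\<kappa> + \<eta>) * t)"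
proof -
  let ?q = "real m ^ card U * real n powr (- \<gamma>)"
  have q0: "0 \<le> ?q" by simp
  have t0: "0 \<le> t" using st by simp
  have k0: "0 \<le> \<kappa> * t"
  proof -
    have "0 \<le> \<kappa> * \<nu>" using absorbed[OF xy] by (rule order_trans[rotated]) simp
    then have "0 \<le> \<kappa>" using nu_pos by (simp add: zero_le_mult_iff)
    then show ?thesis using t0 by simp
  qed
  have fibre: "(\<Sum>\<phi> | \<phi> \<in> rungs n {x, y} \<and> hits W \<phi> = S. p ^ card (rung_edges x y \<phi> - A) * g \<phi>)
      \<le> \<nu> * (((if S = {} then s else 0) + (if S = U then (\<kappa> + ?q) * t else 0)) + ?q * t)" (is "?l \<le> _") if "S \<in> Pow U" for S
  proof -
    have SU: "S \<subseteq> U" using that by simp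
    have Une: "U \<noteq> {}" using cdU by auto
    have kq: "0 \<le> (\<kappa> + ?q) * t" using k0 q0 t0 by (simp add: algebra_simps)
    consider "S = {}" | "S = U" | "S \<noteq> {}" "S \<noteq> U" by blast
    then show ?thesis
    proof cases
      case 1
      then have "?l \<le> \<nu> * s" using fibre_no_hits[of x y s g] xy st(1) gs cdU by (auto simp: hits_def)
      also have "\<dots> \<le> \<nu> * ((s + 0) + ?q * t)"
        using nu_pos q0 t0 by (intro mult_left_mono) auto
      finally show ?thesis using 1 Une by simp
    next
      case 2
      then have "?l \<le> \<nu> * ((\<kappa> + ?q) * t)" using fibre_full[of x y t g] xy t0 gt by simp
      also have "\<dots> \<le> \<nu> * ((0 + (\<kappa> + ?q) * t) + ?q * t)"
        using nu_pos q0 t0 by (intro mult_left_mono) auto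
      finally show ?thesis using 2 Une by simp
    next
      case 3
      have "?l \<le> \<nu> * (?q * t)" by (rule fibre_partial) (use xy SU 3 t0 gt in auto)
      then show ?thesis using 3 by simp
    qed
  qed
  have "(\<Sum>\<phi>\<in>rungs n {x, y}. p ^ card (rung_edges x y \<phi> - A) * g \<phi>)
      \<le> (\<Sum>S\<in>Pow U. \<nu> * (((if S = {} then s else 0) + (if S = U then (\<kappa> + ?q) * t else 0)) + ?q * t))"
    unfolding sum_by_hits by (rule sum_mono[OF fibre])
  also have "\<dots> = \<nu> * (s + (\<kappa> + ?q) * t + 2 ^ card U * (?q * t))"
    using finU by (simp add: sum_distrib_left[symmetric] sum.distrib card_Pow)
  also have "\<dots> = \<nu> * (s + (\<kappa> + \<eta>) * t)" unfolding \<eta>_def by (simp add: algebra_simps)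
  finally show ?thesis .
qed

text \<open>
Solution of the recursion. From a pair outside \<open>W\<close> the sum exceeds its disjoint part by at most \<open>\<tau>\<close> per
rung. From a pair inside \<open>W\<close>, following the first ladder for some rungs and then leaving yields a
geometric series in \<open>\<kappa>'\<close>, and following it to the very end yields \<open>\<kappa>' ^ i / p\<close>, where \<open>1/p\<close> stems from the
shared final edge.
\<close>

lemma overlap_sum_bound:
  assumes k': "\<kappa> + \<eta> \<le> \<kappa>'" "0 \<le> \<kappa>'" "\<kappa>' \<le> 1 / 2"
    and tau: "2 * \<eta> + \<zeta> * (4 + 1 / p) \<le> \<tau>" "real L * \<tau> \<le> 1"
    and "i \<le> L" "x \<noteq> y"
  shows "overlap_sum n p A i x y \<le> p * \<nu> ^ i *
    (if {x, y} \<subseteq> W then (1 + real L * \<tau>) / (1 - \<kappa>') + \<kappa>' ^ i / p else 1 + real i * \<tau>)"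
  using assms(6,7)
proof (induction i arbitrary: x y)
  case 0
  have tau0: "0 \<le> \<tau>" using tau(1) eta_nonneg zeta_nonneg p0
    by (intro order_trans[OF _ tau(1)]) auto
  have "1 \<le> p * ((1 + real L * \<tau>) / (1 - \<kappa>') + 1 / p)"
    using p0 k' tau0 by (simp add: distrib_left)
  moreover have "{x, y} \<notin> A" if "\<not> {x, y} \<subseteq> W" using that AW by blast
  ultimately show ?case using p1 by (auto simp: insert_commute)
next
  case (Suc i)
  have tau0: "0 \<le> \<tau>" using tau(1) eta_nonneg zeta_nonneg p0
    by (intro order_trans[OF _ tau(1)]) auto
  define \<alpha> where "\<alpha> = 1 + real i * \<tau>"
  define \<Lambda> where "\<Lambda> = 1 + real L * \<tau>"
  define \<beta> where "\<beta> = \<Lambda> / (1 - \<kappa>') + \<kappa>' ^ i / p"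
  define s where "s = p * \<nu> ^ i * \<alpha>"
  define t where "t = p * \<nu> ^ i * \<beta>"
  have w0: "0 < p * \<nu> ^ i" using p0 nu_pos by simp
  have aL: "\<alpha> \<le> \<Lambda>" unfolding \<alpha>_def \<Lambda>_def using Suc.prems(1) tau0 by (simp add: mult_right_mono)
  have a1: "1 \<le> \<alpha>" unfolding \<alpha>_def using tau0 by simp
  have L2: "\<Lambda> \<le> 2" unfolding \<Lambda>_def using tau by simp
  have "\<Lambda> \<le> \<Lambda> / (1 - \<kappa>')" using k' aL a1 by (simp add: pos_le_divide_eq algebra_simps)
  moreover have "0 \<le> \<kappa>' ^ i / p" using k' p0 by simp
  ultimately have ab': "\<alpha> \<le> \<beta>" using aL unfolding \<beta>_def by linarith
  have st: "0 \<le> s" "s \<le> t"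
    unfolding s_def t_def using w0 a1 ab' by (auto intro: mult_left_mono)
  have IH: "overlap_sum n p A i (\<phi> c) (\<phi> d) \<le> (if {\<phi> c, \<phi> d} \<subseteq> W then t else s)" if "\<phi> \<in> rungs n {x, y}" for \<phi>
    using Suc.IH[of "\<phi> c" "\<phi> d"] Suc.prems(1) rungsD(6)[OF that]
    unfolding s_def t_def \<alpha>_def \<beta>_def \<Lambda>_def by auto
  have gt: "overlap_sum n p A i (\<phi> c) (\<phi> d) \<le> t" if "\<phi> \<in> rungs n {x, y}" for \<phi>
    using IH[OF that] st(2) by (auto split: if_splits)
  have gs: "overlap_sum n p A i (\<phi> c) (\<phi> d) \<le> s" if "\<phi> \<in> rungs n {x, y}" "\<not> {\<phi> c, \<phi> d} \<subseteq> W" for \<phi>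
    using IH[OF that(1)] that(2) by auto
  show ?case
  proof (cases "{x, y} \<subseteq> W")
    case True
    have "overlap_sum n p A (Suc i) x y \<le> \<nu> * (s + (\<kappa> + \<eta>) * t)"
      unfolding overlap_sum.simps by (rule rung_step_inside[OF Suc.prems(2) st gt gs])
    also have "\<dots> \<le> \<nu> * (p * \<nu> ^ i * \<Lambda> + \<kappa>' * t)"
      using nu_pos aL w0 k' st unfolding s_def
      by (intro mult_left_mono add_mono mult_right_mono) auto
    also have "\<dots> = p * \<nu> ^ Suc i * (\<Lambda> + \<kappa>' * \<beta>)" unfolding t_def by (simp add: algebra_simps)
    also have "\<Lambda> + \<kappa>' * \<beta> = \<Lambda> / (1 - \<kappa>') + \<kappa>' ^ Suc i / p"
      using k' p0 unfolding \<beta>_def by (simp add: field_simps)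
    finally show ?thesis using True unfolding \<Lambda>_def by (simp only: if_True)
  next
    case False
    have "overlap_sum n p A (Suc i) x y \<le> \<nu> * ((1 + \<eta>) * s + \<zeta> * t)"
      unfolding overlap_sum.simps by (rule rung_step_outside[OF Suc.prems(2) False st gt gs])
    also have "\<dots> = p * \<nu> ^ Suc i * (\<alpha> + (\<eta> * \<alpha> + \<zeta> * \<beta>))"
      unfolding s_def t_def by (simp add: algebra_simps)
    also have "\<dots> \<le> p * \<nu> ^ Suc i * (\<alpha> + \<tau>)"
    proof (intro mult_left_mono add_left_mono)
      have "\<Lambda> / (1 - \<kappa>') \<le> 4"
        using k' L2 by (simp add: pos_divide_le_eq)
      moreover have "\<kappa>' ^ i \<le> 1" using k' by (intro power_le_one) auto
      then have "\<kappa>' ^ i / p \<le> 1 / p" using p0 by (simp add: divide_right_mono)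
      ultimately have "\<beta> \<le> 4 + 1 / p" unfolding \<beta>_def by linarith
      then have "\<zeta> * \<beta> \<le> \<zeta> * (4 + 1 / p)" using zeta_nonneg by (intro mult_left_mono)
      moreover have "\<eta> * \<alpha> \<le> \<eta> * 2" using eta_nonneg aL L2 by (intro mult_left_mono) auto
      ultimately show "\<eta> * \<alpha> + \<zeta> * \<beta> \<le> \<tau>" using tau(1) by linarith
    qed (use p0 nu_pos in auto)
    also have "\<alpha> + \<tau> = 1 + real (Suc i) * \<tau>" unfolding \<alpha>_def by (simp add: algebra_simps)
    finally show ?thesis using False by (simp only: if_False)
  qed
qed

end

context balanced_rung begin

text \<open>
The second moment method for the number of ladders on \<open>xy\<close> in the random graph. The hypothesis \<open>count\<close>
says that the overlap sum of every ladder exceeds the mean number of ladders at most by the factor \<open>1 + \<epsilon>\<close>.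
\<close>

lemma prob_infected_ge:
  fixes n m L :: nat and p \<gamma> \<kappa> \<kappa>' \<tau> \<nu> \<epsilon> :: real
  defines "\<nu> \<equiv> real n ^ card U * p ^ card R"
    and "\<eta> \<equiv> (2 ^ card U + 1) * (real m ^ card U * real n powr (- \<gamma>))"
    and "\<zeta> \<equiv> 2 ^ card U * (real m ^ card U / real n)"
  assumes n1: "1 \<le> n" and p: "0 < p" "p \<le> 1" "real n powr (- 1 / lm) \<le> p"
    and gap: "\<And>S. S \<subseteq> U \<Longrightarrow> S \<noteq> {} \<Longrightarrow> S \<noteq> U \<Longrightarrow> real (e_in (S \<union> {a, b})) \<le> lm * (real (card S) - \<gamma>)"
    and absorbed: "real absorbed_bound \<le> \<kappa> * \<nu>" and p_small: "p \<le> \<nu> * real n powr (- \<gamma>)"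
    and m: "L * card U + 2 \<le> m"
    and k': "\<kappa> + \<eta> \<le> \<kappa>'" "0 \<le> \<kappa>'" "\<kappa>' \<le> 1 / 2"
    and tau: "2 * \<eta> + \<zeta> * (4 + 1 / p) \<le> \<tau>" "real L * \<tau> \<le> 1"
    and count: "real n ^ (L * card U) * ((1 + real L * \<tau>) / (1 - \<kappa>') + \<kappa>' ^ L / p)
      \<le> (1 + \<epsilon>) * real (n - 2 - L * card U) ^ (L * card U)"
    and ladders_exist: "2 + L * card U < n" and eps: "0 \<le> \<epsilon>"
    and xy: "x \<in> {1..n}" "y \<in> {1..n}" "x \<noteq> y"
  shows "measure_pmf.prob (random_edges n p) {Y. {x, y} \<in> infected \<lparr>verts = V, edges = E\<rparr> n Y} \<ge> 1 - \<epsilon>"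
proof -
  define I where "I = ladders n L {x, y}"
  define M where "M = L * card R + 1"
  define Ev where "Ev B = {Y. ladder_edges B x y \<subseteq> Y}" for B
  define bd where "bd = (1 + real L * \<tau>) / (1 - \<kappa>') + \<kappa>' ^ L / p"
  have finI: "finite I" by (simp add: I_def finite_ladders)
  have sub: "ladder_edges B x y \<subseteq> pairs_of {1..n}" if "B \<in> I" for B
    using ladder_edges_pairs[of B n L "{x, y}" x y] ladder_verts[of B n L "{x, y}"] that xy
    unfolding I_def pairs_of_def by fastforce
  have cM: "card (ladder_edges B x y) = M" if "B \<in> I" for B
    using card_ladder_edges[of B n L "{x, y}" x y] that xy(3) by (simp add: I_def M_def)
  have prob1: "measure_pmf.prob (random_edges n p) (Ev B) = p ^ M" if "B \<in> I" for B
    using prob_random_edges_superset[OF sub[OF that], of p] p cM[OF that] by (simp add: Ev_def)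
  have prob2: "measure_pmf.prob (random_edges n p) (Ev B \<inter> Ev B')
      = p ^ M * p ^ card (ladder_edges B' x y - ladder_edges B x y)" if "B \<in> I" "B' \<in> I" for B B'
  proof -
    have "Ev B \<inter> Ev B' = {Y. ladder_edges B x y \<union> ladder_edges B' x y \<subseteq> Y}" by (auto simp: Ev_def)
    then have "measure_pmf.prob (random_edges n p) (Ev B \<inter> Ev B') = p ^ card (ladder_edges B x y \<union> ladder_edges B' x y)"
      using prob_random_edges_superset[of "ladder_edges B x y \<union> ladder_edges B' x y" n p] sub that p by auto
    also have "ladder_edges B x y \<union> ladder_edges B' x y
        = ladder_edges B x y \<union> (ladder_edges B' x y - ladder_edges B x y)" by blast
    also have "card \<dots> = M + card (ladder_edges B' x y - ladder_edges B x y)"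
      by (subst card_Un_disjoint) (auto simp: finite_ladder_edges cM[OF that(1)])
    finally show ?thesis by (simp add: power_add)
  qed
  have inner: "(\<Sum>B'\<in>I. p ^ card (ladder_edges B' x y - ladder_edges B x y)) \<le> p * \<nu> ^ L * bd" if B: "B \<in> I" for B
  proof -
    let ?A = "ladder_edges B x y" and ?W = "{x, y} \<union> new_verts B"
    have B': "B \<in> ladders n L {x, y}" using B by (simp add: I_def)
    have Apairs: "?A \<subseteq> pairs_of ?W" using ladder_edges_pairs[OF B' _ _ xy(3)] by simp
    have absorbed': "real (card {\<phi> \<in> rungs n {x', y'}. rung_edges x' y' \<phi> \<subseteq> ?A}) \<le> \<kappa> * \<nu>" if "x' \<noteq> y'" for x' y'
      using card_absorbed_rungs[OF finite_ladder_edges Apairs ladder_degree[OF B' _ _ xy(3)] that, of n] absorbed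
      by (simp add: order_trans[OF of_nat_mono])
    have "card ?W \<le> card {x, y} + card (new_verts B)" by (rule card_Un_le)
    also have "\<dots> \<le> m" using card_new_verts[of B] ladder_verts[OF B'] m xy(3) by simp
    finally have cW: "card ?W \<le> m" .
    interpret ladder_overlap V E a b c d lm n m p \<gamma> \<kappa> \<nu> ?A ?W
    proof (unfold_locales)
      show "?A \<subseteq> Pow ?W" using Apairs unfolding pairs_of_def by blast
      show "finite ?W" using finite_new_verts by simp
      show "1 \<le> m" using m by simp
      show "\<nu> = real n ^ card U * p ^ card R" by (simp add: \<nu>_def)
    qed (fact n1 p gap absorbed' p_small cW)+
    have "(\<Sum>B'\<in>I. p ^ card (ladder_edges B' x y - ?A)) \<le> overlap_sum n p ?A L x y"
      unfolding I_def by (rule sum_ladders_le_overlap_sum) (use p xy in auto)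
    also have "\<dots> \<le> p * \<nu> ^ L * (if {x, y} \<subseteq> ?W then (1 + real L * \<tau>) / (1 - \<kappa>') + \<kappa>' ^ L / p else 1 + real L * \<tau>)"
      by (rule overlap_sum_bound[OF _ k'(2,3) _ tau(2) order_refl xy(3)])
         (use k'(1) tau(1) in \<open>simp_all only: \<eta>_def \<zeta>_def assms(1-3)\<close>)
    finally show ?thesis unfolding bd_def by simp
  qed
  define \<mu> where "\<mu> = (\<Sum>B\<in>I. measure_pmf.prob (random_edges n p) (Ev B))"
  have mu: "\<mu> = real (card I) * p ^ M" unfolding \<mu>_def by (simp add: prob1)
  have cI: "real (n - 2 - L * card U) ^ (L * card U) \<le> real (card I)"
    using card_ladders_ge[of "{x, y}" n L] xy of_nat_mono unfolding I_def by fastforce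
  have "0 < n - 2 - L * card U" using ladders_exist by linarith
  then have "0 < real (n - 2 - L * card U) ^ (L * card U)" by (intro zero_less_power) (simp only: of_nat_0_less_iff)
  then have cI0: "0 < real (card I)" using cI by linarith
  have bd_le: "p * \<nu> ^ L * bd \<le> (1 + \<epsilon>) * (real (card I) * p ^ M)"
  proof -
    have "p * \<nu> ^ L = real n ^ (L * card U) * p ^ M"
      by (simp add: \<nu>_def M_def power_mult_distrib power_mult[symmetric] mult.commute)
    then have "p * \<nu> ^ L * bd = (real n ^ (L * card U) * bd) * p ^ M" by simp
    also have "\<dots> \<le> ((1 + \<epsilon>) * real (card I)) * p ^ M"
      using count cI eps p unfolding bd_def[symmetric]
      by (intro mult_right_mono order_trans[OF count[folded bd_def]] mult_left_mono) auto
    finally show ?thesis by simp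
  qed
  have "measure_pmf.prob (random_edges n p) (\<Union>B\<in>I. Ev B) \<ge> 1 - \<epsilon>"
  proof (rule second_moment_method[OF finI \<mu>_def])
    show "0 < \<mu>" unfolding mu using cI0 p by simp
    have "(\<Sum>B\<in>I. \<Sum>B'\<in>I. measure_pmf.prob (random_edges n p) (Ev B \<inter> Ev B'))
        = (\<Sum>B\<in>I. p ^ M * (\<Sum>B'\<in>I. p ^ card (ladder_edges B' x y - ladder_edges B x y)))"
      unfolding sum_distrib_left by (intro sum.cong refl prob2)
    also have "\<dots> \<le> (\<Sum>B\<in>I. p ^ M * ((1 + \<epsilon>) * (real (card I) * p ^ M)))"
      using p by (intro sum_mono mult_left_mono order_trans[OF inner bd_le]) auto
    also have "\<dots> = (1 + \<epsilon>) * \<mu>\<^sup>2" by (simp add: mu power2_eq_square)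
    finally show "(\<Sum>B\<in>I. \<Sum>B'\<in>I. measure_pmf.prob (random_edges n p) (Ev B \<inter> Ev B')) \<le> (1 + \<epsilon>) * \<mu>\<^sup>2" .
  qed
  also have "measure_pmf.prob (random_edges n p) (\<Union>B\<in>I. Ev B)
      \<le> measure_pmf.prob (random_edges n p) {Y. {x, y} \<in> infected \<lparr>verts = V, edges = E\<rparr> n Y}"
    using ladder_infected[of _ n L "{x, y}" x y] xy
    by (intro measure_pmf.finite_measure_mono) (auto simp: I_def Ev_def)
  finally show ?thesis .
qed

end

section \<open>A fixed pair is infected with high probability\<close>

lemma polylog_times_negative_power:
  fixes \<sigma> :: real and j :: nat
  assumes "0 < \<sigma>"
  shows "(\<lambda>n. (ln (real n) + 1) ^ j * real n powr (- \<sigma>)) \<longlonglongrightarrow> 0"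
  using assms by real_asymp

context balanced_rung begin

text \<open>
The choice of parameters. The second moment ratio tends to \<open>1 / (1 - \<kappa>')\<close>, so \<open>\<kappa>'\<close> is fixed first, in terms of
\<open>\<epsilon>\<close>. Then \<open>C\<close> is taken so large that absorbed rungs have relative weight at most \<open>\<kappa>'/2\<close>, and ladders of length
about \<open>ln n\<close> make the contribution \<open>\<kappa>' ^ L / p\<close> of complete overlaps vanish.
\<close>

lemma eventually_prob_infected:
  assumes eps: "0 < \<epsilon>"
  shows "\<exists>C\<ge>1. \<forall>\<^sub>F n in sequentially. C * real n powr (- 1 / lm) \<le> 1 \<and>
    (\<forall>x\<in>{1..n}. \<forall>y\<in>{1..n}. x \<noteq> y \<longrightarrow>
      measure_pmf.prob (random_edges n (C * real n powr (- 1 / lm)))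
        {Y. {x, y} \<in> infected \<lparr>verts = V, edges = E\<rparr> n Y} \<ge> 1 - \<epsilon>)"
proof -
  obtain \<gamma> where \<gamma>: "0 < \<gamma>" "\<gamma> \<le> 1 / lm" and
    gap: "\<And>S. S \<subseteq> U \<Longrightarrow> S \<noteq> {} \<Longrightarrow> S \<noteq> U \<Longrightarrow> real (e_in (S \<union> {a, b})) \<le> lm * (real (card S) - \<gamma>)"
    using density_gap by blast
  \<comment> \<open>The bound \<open>exp (- 2)\<close> makes \<open>\<kappa>' ^ ln n\<close> at most \<open>1 / n\<^sup>2\<close>, which beats \<open>1/p\<close>.\<close>
  define \<kappa>' where "\<kappa>' = min (exp (- 2)) (\<epsilon> / (2 * (1 + \<epsilon>)))"
  have e2: "exp (- 2 :: real) \<le> 1 / 2"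
    using exp_ge_add_one_self[of 2] by (simp add: exp_minus field_simps)
  have k'0: "0 < \<kappa>'" and k'e: "\<kappa>' \<le> exp (- 2)"
    using eps by (simp_all add: \<kappa>'_def)
  have k'h: "\<kappa>' \<le> 1 / 2" using k'e e2 by linarith
  have k'eps: "1 / (1 - \<kappa>') < 1 + \<epsilon>"
  proof -
    have "\<kappa>' \<le> \<epsilon> / (2 * (1 + \<epsilon>))" by (simp add: \<kappa>'_def)
    then have "\<kappa>' * (1 + \<epsilon>) \<le> \<epsilon> / 2" using eps by (simp add: field_simps)
    then have "1 < (1 + \<epsilon>) * (1 - \<kappa>')" using eps by (simp add: algebra_simps)
    then show ?thesis using k'h by (simp add: pos_divide_less_eq)
  qed
  define \<kappa> where "\<kappa> = \<kappa>' / 2"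
  define C where "C = max 1 (real absorbed_bound / \<kappa>)"
  have C1: "1 \<le> C" by (simp add: C_def)
  have k0: "0 < \<kappa>" using k'0 by (simp add: \<kappa>_def)
  have CK: "real absorbed_bound \<le> \<kappa> * C"
  proof -
    have "real absorbed_bound / \<kappa> \<le> C" by (simp add: C_def)
    then show ?thesis using k0 by (simp add: field_simps)
  qed
  have R1: "1 \<le> card R" using cardR cardE by simp
  have CR: "C \<le> C ^ card R" using C1 R1 by (intro self_le_power) auto
  define u where "u = card U"
  define k where "k = real (u + 2)"
  define p where "p n = C * real n powr (- 1 / lm)" for n
  define L where "L n = nat \<lceil>ln (real n)\<rceil>" for n
  define m where "m n = L n * u + 2" for n
  define eta where "eta n = (2 ^ u + 1) * (real (m n) ^ u * real n powr (- \<gamma>))" for n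
  define zeta where "zeta n = 2 ^ u * (real (m n) ^ u / real n)" for n
  define tau where "tau n = 2 * eta n + zeta n * (4 + 1 / p n)" for n
  define l where "l n = ln (real n) + 1" for n
  have n3: "\<forall>\<^sub>F n in sequentially. 3 \<le> n" by (rule eventually_ge_at_top)
  have Lge: "ln (real n) \<le> real (L n)" "1 \<le> L n" and Lle: "real (L n) \<le> l n" and l1: "1 \<le> l n"
    if "3 \<le> n" for n
  proof -
    have "0 < ln (real n)" using that by (intro ln_gt_zero) simp
    then show "ln (real n) \<le> real (L n)" "1 \<le> L n" "real (L n) \<le> l n" "1 \<le> l n"
      unfolding L_def l_def by linarith+
  qed
  have mle: "real (m n) \<le> k * l n" if "3 \<le> n" for n
  proof -
    have "real (m n) = real (L n) * real u + 2" by (simp add: m_def)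
    also have "\<dots> \<le> l n * real u + 2 * l n"
      using Lle[OF that] l1[OF that] by (intro add_mono mult_right_mono) auto
    also have "\<dots> = k * l n" by (simp add: k_def algebra_simps)
    finally show ?thesis .
  qed
  have pinv: "1 / p n \<le> real n powr (1 / lm)" if "3 \<le> n" for n
  proof -
    have "1 / p n = (1 / C) * real n powr (1 / lm)"
      using that by (simp add: p_def powr_minus divide_inverse)
    also have "\<dots> \<le> 1 * real n powr (1 / lm)" using C1 by (intro mult_right_mono) auto
    finally show ?thesis by simp
  qed
  have p0: "0 < p n" if "3 \<le> n" for n using C1 that by (simp add: p_def)
  have eta0: "0 \<le> eta n" and zeta0: "0 \<le> zeta n" for n by (simp_all add: eta_def zeta_def)
  \<comment> \<open>An explicit upper bound for \<open>L \<tau>\<close>, a sum of powers of logarithms times negative powers of \<open>n\<close>.\<close>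
  define bnd where "bnd n = 2 * (2 ^ u + 1) * k ^ u * (l n ^ (u + 1) * real n powr (- \<gamma>))
      + 2 ^ u * k ^ u * (4 * (l n ^ (u + 1) * real n powr (- 1)) + l n ^ (u + 1) * real n powr (- (1 - 1 / lm)))" for n
  have bnd: "real (L n) * tau n \<le> bnd n" if n: "3 \<le> n" for n
  proof -
    have n0: "0 < real n" using n by simp
    have mu: "real (m n) ^ u \<le> k ^ u * l n ^ u"
      using mle[OF n] by (simp add: power_mult_distrib[symmetric] power_mono)
    have "eta n \<le> (2 ^ u + 1) * (k ^ u * l n ^ u * real n powr (- \<gamma>))"
      unfolding eta_def by (intro mult_left_mono mult_right_mono mu) auto
    moreover have "zeta n * (4 + 1 / p n) \<le> 2 ^ u * (k ^ u * l n ^ u * real n powr (- 1)) * (4 + real n powr (1 / lm))"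
    proof (rule mult_mono)
      show "zeta n \<le> 2 ^ u * (k ^ u * l n ^ u * real n powr (- 1))"
        unfolding zeta_def using mu n0 by (simp add: powr_minus_divide divide_right_mono)
    qed (use pinv[OF n] p0[OF n] l1[OF n] in \<open>auto simp: k_def\<close>)
    ultimately have "tau n \<le> 2 * ((2 ^ u + 1) * (k ^ u * l n ^ u * real n powr (- \<gamma>)))
        + 2 ^ u * (k ^ u * l n ^ u * real n powr (- 1)) * (4 + real n powr (1 / lm))"
      unfolding tau_def by linarith
    also have "\<dots> = 2 * (2 ^ u + 1) * k ^ u * (l n ^ u * real n powr (- \<gamma>))
        + 2 ^ u * k ^ u * (4 * (l n ^ u * real n powr (- 1)) + l n ^ u * (real n powr (- 1) * real n powr (1 / lm)))"
      by (simp only: distrib_left distrib_right ac_simps)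
    also have "real n powr (- 1) * real n powr (1 / lm) = real n powr (- 1 + 1 / lm)"
      by (rule powr_add[symmetric])
    also have "- 1 + 1 / lm = - (1 - 1 / lm)" by simp
    finally have "real (L n) * tau n \<le> l n * (2 * (2 ^ u + 1) * k ^ u * (l n ^ u * real n powr (- \<gamma>))
        + 2 ^ u * k ^ u * (4 * (l n ^ u * real n powr (- 1)) + l n ^ u * real n powr (- (1 - 1 / lm))))"
      using Lle[OF n] l1[OF n] by (intro mult_mono) (auto simp: k_def tau_def eta0 zeta0 less_imp_le[OF p0[OF n]])
    also have "\<dots> = bnd n" by (simp add: bnd_def algebra_simps)
    finally show ?thesis .
  qed
  have "(\<lambda>n. bnd n) \<longlonglongrightarrow> 2 * (2 ^ u + 1) * k ^ u * 0 + 2 ^ u * k ^ u * (4 * 0 + 0)"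
    unfolding bnd_def l_def using \<gamma>(1) lm1
    by (intro tendsto_intros polylog_times_negative_power) auto
  then have bnd0: "bnd \<longlonglongrightarrow> 0" by simp
  have Ltau: "(\<lambda>n. real (L n) * tau n) \<longlonglongrightarrow> 0"
  proof (rule tendsto_sandwich[OF _ _ tendsto_const bnd0])
    show "\<forall>\<^sub>F n in sequentially. 0 \<le> real (L n) * tau n"
      using n3 by eventually_elim (simp add: tau_def eta0 zeta0 less_imp_le[OF p0])
    show "\<forall>\<^sub>F n in sequentially. real (L n) * tau n \<le> bnd n"
      using n3 by eventually_elim (rule bnd)
  qed
  define X where "X n = (1 + real (L n) * tau n) / (1 - \<kappa>') + \<kappa>' ^ L n / p n" for n
  \<comment> \<open>By Bernoulli's inequality, \<open>\<delta>\<close> bounds the fraction of ladders lost by requiring distinct vertices.\<close>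
  define \<delta> where "\<delta> n = real (L n * u) * (real (2 + L n * u) / real n)" for n
  have tail: "\<kappa>' ^ L n / p n \<le> 1 / real n" if n: "3 \<le> n" for n
  proof -
    have n0: "0 < real n" using n by simp
    have "\<kappa>' ^ L n \<le> exp (- 2) ^ L n" using k'0 k'e by (intro power_mono) auto
    also have "\<dots> = exp (- (2 * real (L n)))" by (simp add: exp_of_nat_mult[symmetric] mult.commute)
    also have "\<dots> \<le> exp (- (2 * ln (real n)))" using Lge[OF n] by simp
    also have "\<dots> = real n powr (- 2)" using n0 by (simp add: powr_def)
    finally have "\<kappa>' ^ L n * (1 / p n) \<le> real n powr (- 2) * real n powr (1 / lm)"
      using pinv[OF n] p0[OF n] by (intro mult_mono) auto
    also have "\<dots> = real n powr (- 2 + 1 / lm)" by (rule powr_add[symmetric])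
    also have "\<dots> \<le> real n powr (- 1)" using n lm1 by (intro powr_mono) auto
    finally show ?thesis using n0 by (simp add: powr_minus_divide)
  qed
  have tail0: "(\<lambda>n. \<kappa>' ^ L n / p n) \<longlonglongrightarrow> 0"
  proof (rule tendsto_sandwich[OF _ _ tendsto_const lim_1_over_n])
    show "\<forall>\<^sub>F n in sequentially. 0 \<le> \<kappa>' ^ L n / p n"
      using n3 by eventually_elim (use k'0 p0 in \<open>auto intro!: divide_nonneg_pos\<close>)
    show "\<forall>\<^sub>F n in sequentially. \<kappa>' ^ L n / p n \<le> 1 / real n"
      using n3 by eventually_elim (rule tail)
  qed
  have X: "X \<longlonglongrightarrow> (1 + 0) / (1 - \<kappa>') + 0"
    unfolding X_def using k'h by (intro tendsto_intros Ltau tail0) auto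
  have polylog_sq: "(\<lambda>n. k\<^sup>2 * ((ln (real n) + 1) ^ 2 * real n powr (- 1))) \<longlonglongrightarrow> k\<^sup>2 * 0"
    by (intro tendsto_mult tendsto_const polylog_times_negative_power) simp
  have \<delta>0: "\<delta> \<longlonglongrightarrow> 0"
  proof (rule tendsto_sandwich[OF _ _ tendsto_const])
    show "(\<lambda>n. k\<^sup>2 * ((ln (real n) + 1) ^ 2 * real n powr (- 1))) \<longlonglongrightarrow> 0" using polylog_sq by simp
    show "\<forall>\<^sub>F n in sequentially. 0 \<le> \<delta> n" by (simp add: \<delta>_def)
    show "\<forall>\<^sub>F n in sequentially. \<delta> n \<le> k\<^sup>2 * ((ln (real n) + 1) ^ 2 * real n powr (- 1))"
      using n3
    proof eventually_elim
      case (elim n)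
      have m': "real (2 + L n * u) \<le> k * l n" using mle[OF elim] by (simp add: m_def)
      have "\<delta> n \<le> (k * l n) * ((k * l n) / real n)"
        unfolding \<delta>_def using m' order_trans[OF of_nat_0_le_iff m']
        by (intro mult_mono divide_right_mono) auto
      also have "\<dots> = k\<^sup>2 * ((ln (real n) + 1) ^ 2 * real n powr (- 1))"
        using elim by (simp add: l_def power2_eq_square powr_minus_divide)
      finally show ?case .
    qed
  qed
  have "(\<lambda>n. (1 + \<epsilon>) * (1 - \<delta> n) - X n) \<longlonglongrightarrow> (1 + \<epsilon>) * (1 - 0) - ((1 + 0) / (1 - \<kappa>') + 0)"
    by (intro tendsto_intros \<delta>0 X)
  then have "\<forall>\<^sub>F n in sequentially. 0 < (1 + \<epsilon>) * (1 - \<delta> n) - X n"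
    by (rule order_tendstoD(1)) (use k'eps in simp)
  then have count: "\<forall>\<^sub>F n in sequentially. X n \<le> (1 + \<epsilon>) * (1 - \<delta> n)"
    by eventually_elim simp
  have d1: "\<forall>\<^sub>F n in sequentially. \<delta> n < 1" by (rule order_tendstoD(2)[OF \<delta>0]) simp
  have tau1: "\<forall>\<^sub>F n in sequentially. real (L n) * tau n < min 1 \<kappa>"
    by (rule order_tendstoD(2)[OF Ltau]) (use k0 in simp)
  have "(\<lambda>n. real n powr (- (1 / lm))) \<longlonglongrightarrow> 0"
    using polylog_times_negative_power[of "1 / lm" 0] lm1 by simp
  then have "\<forall>\<^sub>F n in sequentially. real n powr (- (1 / lm)) < 1 / C"
    by (rule order_tendstoD(2)) (use C1 in simp)
  then have psmall: "\<forall>\<^sub>F n in sequentially. p n \<le> 1"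
    by eventually_elim (use C1 in \<open>simp add: p_def field_simps\<close>)
  have u2: "1 \<le> u" unfolding u_def using cardU cardV by simp
  have main: "\<forall>\<^sub>F n in sequentially. p n \<le> 1 \<and>
    (\<forall>x\<in>{1..n}. \<forall>y\<in>{1..n}. x \<noteq> y \<longrightarrow>
      measure_pmf.prob (random_edges n (p n)) {Y. {x, y} \<in> infected \<lparr>verts = V, edges = E\<rparr> n Y} \<ge> 1 - \<epsilon>)"
    using n3 count d1 tau1 psmall
  proof eventually_elim
    case (elim n)
    have n0: "0 < real n" and n1: "1 \<le> n" using elim(1) by auto
    have nu: "real n ^ card U * p n ^ card R = C ^ card R"
    proof -
      have "p n ^ card R = C ^ card R * real n powr (- real (card R) / lm)"
        using n0 by (simp add: p_def power_mult_distrib powr_power)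
      also have "real (card R) / lm = real (card U)" using lm_cardU lm1 by (simp add: field_simps)
      then have "real n powr (- real (card R) / lm) = 1 / real n ^ card U"
        using n0 by (simp add: powr_minus_divide powr_realpow)
      finally show ?thesis using n0 by simp
    qed
    have two_eta: "2 * eta n \<le> tau n"
      unfolding tau_def using zeta0[of n] less_imp_le[OF p0[OF elim(1)]] by simp
    have tau0: "0 \<le> tau n" using two_eta eta0[of n] by linarith
    then have "tau n \<le> real (L n) * tau n"
      using Lge(2)[OF elim(1)] mult_right_mono[of 1 "real (L n)" "tau n"] by simp
    then have etak: "eta n \<le> \<kappa>" using two_eta eta0[of n] elim(4) by linarith
    have sub: "real (2 + L n * u) < real n"
    proof -
      have "real (2 + L n * u) / real n \<le> real (L n * u) * (real (2 + L n * u) / real n)"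
      proof -
        have "1 \<le> L n * u" using mult_le_mono[OF Lge(2)[OF elim(1)] u2] by simp
        then have "real 1 \<le> real (L n * u)" by (rule of_nat_mono)
        then have "1 \<le> real (L n * u)" by (simp only: of_nat_1)
        then show ?thesis using mult_right_mono[of 1 "real (L n * u)" "real (2 + L n * u) / real n"] by simp
      qed
      then have "real (2 + L n * u) / real n < 1" using elim(3) unfolding \<delta>_def by linarith
      then show ?thesis using n0 by (simp add: pos_divide_less_eq)
    qed
    then have sub': "2 + L n * card U < n" unfolding u_def by (simp only: of_nat_less_iff)
    have count': "real n ^ (L n * card U) * X n \<le> (1 + \<epsilon>) * real (n - 2 - L n * card U) ^ (L n * card U)"
    proof -
      let ?x = "real (2 + L n * u) / real n"
      have x1: "?x < 1" using sub n0 by (simp add: pos_divide_less_eq)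
      have "1 - \<delta> n \<le> (1 - ?x) ^ (L n * u)"
        using Bernoulli_inequality[of "- ?x" "L n * u"] x1 by (simp add: \<delta>_def)
      then have "X n \<le> (1 + \<epsilon>) * (1 - ?x) ^ (L n * u)"
        using elim(2) eps by (intro order_trans[OF elim(2)] mult_left_mono) auto
      then have "real n ^ (L n * u) * X n \<le> real n ^ (L n * u) * ((1 + \<epsilon>) * (1 - ?x) ^ (L n * u))"
        by (intro mult_left_mono) auto
      also have "\<dots> = (1 + \<epsilon>) * (real n * (1 - ?x)) ^ (L n * u)" by (simp add: power_mult_distrib)
      also have "real n * (1 - ?x) = real (n - 2 - L n * u)"
      proof -
        have "n - 2 - L n * u = n - (2 + L n * u)" by simp
        then have "real (n - 2 - L n * u) = real n - real (2 + L n * u)"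
          using sub by (simp only: of_nat_diff of_nat_less_iff less_imp_le)
        then show ?thesis using n0 by (simp add: right_diff_distrib)
      qed
      finally show ?thesis unfolding u_def .
    qed
    show ?case
    proof (intro conjI ballI impI elim(5))
      fix x y assume xy: "x \<in> {1..n}" "y \<in> {1..n}" "x \<noteq> y"
      show "measure_pmf.prob (random_edges n (p n)) {Y. {x, y} \<in> infected \<lparr>verts = V, edges = E\<rparr> n Y} \<ge> 1 - \<epsilon>"
      proof (rule prob_infected_ge[where m = "m n" and L = "L n" and \<gamma> = \<gamma> and \<kappa> = \<kappa> and \<kappa>' = \<kappa>' and \<tau> = "tau n"])
        show "real n powr (- 1 / lm) \<le> p n"
          using mult_right_mono[OF C1, of "real n powr (- 1 / lm)"] by (simp add: p_def)
        show "real absorbed_bound \<le> \<kappa> * (real n ^ card U * p n ^ card R)"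
          unfolding nu using CK mult_left_mono[OF CR less_imp_le[OF k0]] by linarith
        show "p n \<le> real n ^ card U * p n ^ card R * real n powr (- \<gamma>)"
          unfolding nu unfolding p_def using CR C1 n1 \<gamma>(2) by (intro mult_mono powr_mono) auto
        show "L n * card U + 2 \<le> m n" by (simp add: m_def u_def)
        show "\<kappa> + (2 ^ card U + 1) * (real (m n) ^ card U * real n powr - \<gamma>) \<le> \<kappa>'"
          using etak unfolding eta_def u_def \<kappa>_def by simp
        show "2 * ((2 ^ card U + 1) * (real (m n) ^ card U * real n powr - \<gamma>)) +
            2 ^ card U * (real (m n) ^ card U / real n) * (4 + 1 / p n) \<le> tau n"
          unfolding tau_def eta_def zeta_def u_def by simp
        show "real (L n) * tau n \<le> 1" using elim(4) by simp
        show "real n ^ (L n * card U) * ((1 + real (L n) * tau n) / (1 - \<kappa>') + \<kappa>' ^ L n / p n)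
            \<le> (1 + \<epsilon>) * real (n - 2 - L n * card U) ^ (L n * card U)"
          using count' unfolding X_def .
      qed (use n1 p0[OF elim(1)] elim(5) gap k'0 k'h sub' eps xy in auto)
    qed
  qed
  show ?thesis using C1 main unfolding p_def by blast
qed

end

section \<open>From almost all pairs to all pairs\<close>

context balanced_rung begin

abbreviation spread_set :: "nat \<Rightarrow> nat set set \<Rightarrow> nat set set" where
  "spread_set n Y \<equiv> infected \<lparr>verts = V, edges = E\<rparr> n Y"

text \<open>
Any \<open>v - 2\<close> vertices of \<open>D\<close> together with \<open>x\<close> and \<open>y\<close> carry a copy of \<open>H\<close> in which \<open>ab\<close> falls on \<open>xy\<close>. All
its other edges are infected, whatever the shape of \<open>H\<close>.
\<close>

lemma infected_of_common_clique:
  assumes xy: "x \<in> {1..n}" "y \<in> {1..n}" "x \<noteq> y"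
    and D: "D \<subseteq> {1..n} - {x, y}" "card U \<le> card D"
    and clique: "\<And>z z'. z \<in> D \<Longrightarrow> z' \<in> D \<Longrightarrow> z \<noteq> z' \<Longrightarrow> {z, z'} \<in> spread_set n Y"
    and joined: "\<And>z. z \<in> D \<Longrightarrow> {x, z} \<in> spread_set n Y \<and> {y, z} \<in> spread_set n Y"
  shows "{x, y} \<in> spread_set n Y"
proof -
  have finD: "finite D" using D(1) by (rule finite_subset) simp
  obtain f where f: "f ` U \<subseteq> D" "inj_on f U" using card_le_inj[OF finU finD D(2)] by blast
  define \<phi> where "\<phi> = restrict f U"
  have img: "\<phi> ` U \<subseteq> D" using f(1) by (auto simp: \<phi>_def)
  have \<phi>: "\<phi> \<in> rungs n {x, y}"
  proof -
    have "\<phi> \<in> U \<rightarrow>\<^sub>E {1..n}" using f(1) D(1) by (auto simp: \<phi>_def)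
    moreover have "inj_on \<phi> U" using f(2) by (simp add: \<phi>_def inj_on_def)
    moreover have "\<phi> ` U \<inter> {x, y} = {}" using img D(1) by blast
    ultimately show ?thesis by (simp add: rungs_def)
  qed
  have inj: "inj_on (place x y \<phi>) V" by (rule inj_on_place[OF \<phi>]) (use xy in auto)
  have pair: "{s, t} \<in> spread_set n Y" if st: "s \<in> {x, y} \<union> D" "t \<in> {x, y} \<union> D" "s \<noteq> t" "{s, t} \<noteq> {x, y}" for s t
  proof -
    have mem: "s = x \<or> s = y \<or> s \<in> D" "t = x \<or> t = y \<or> t \<in> D" using st(1,2) by auto
    consider "s \<in> D" "t \<in> D" | "s \<in> D" "t = x \<or> t = y" | "t \<in> D" "s = x \<or> s = y"
      using mem st(3,4) by (elim disjE) (auto simp: insert_commute)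
    then show ?thesis
    proof cases
      case 1
      then show ?thesis using clique st(3) by blast
    next
      case 2
      then show ?thesis using joined[of s] by (auto simp: insert_commute)
    next
      case 3
      then show ?thesis using joined[of t] by auto
    qed
  qed
  have "place x y \<phi> ` {a, b} \<in> spread_set n Y"
  proof (rule infected.spread)
    show "inj_on (place x y \<phi>) (verts \<lparr>verts = V, edges = E\<rparr>)" using inj by simp
    show "place x y \<phi> ` verts \<lparr>verts = V, edges = E\<rparr> \<subseteq> {1..n}"
      using place_image_V[of x y \<phi>] img D(1) xy by auto
    show "{a, b} \<in> edges \<lparr>verts = V, edges = E\<rparr>" using abE by simp
    fix g assume "g \<in> edges \<lparr>verts = V, edges = E\<rparr>" and ne: "g \<noteq> {a, b}"
    then have gV: "g \<subseteq> V" and "card g = 2" using EV by (auto simp: pairs_of_def)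
    then obtain s t where st: "g = {s, t}" "s \<noteq> t" by (auto simp: card_2_iff)
    have inV: "s \<in> V" "t \<in> V" using gV st(1) by auto
    have "place x y \<phi> s \<noteq> place x y \<phi> t" using inj_on_eq_iff[OF inj inV] st(2) by simp
    moreover have "place x y \<phi> ` g \<noteq> {x, y}"
    proof
      assume "place x y \<phi> ` g = {x, y}"
      then have "place x y \<phi> ` g = place x y \<phi> ` {a, b}" by simp
      then show False using inj_on_image_eq_iff[OF inj gV, of "{a, b}"] ab ne by simp
    qed
    moreover have "place x y \<phi> w \<in> {x, y} \<union> D" if "w \<in> V" for w
      using place_image_V[of x y \<phi>] img that by blast
    ultimately show "place x y \<phi> ` g \<in> spread_set n Y" using pair inV unfolding st(1) by simp
  qed
  then show ?thesis by simp
qed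

text \<open>
Let \<open>A\<close> consist of the vertices with at most \<open>n / (4 v)\<close> missing pairs; counting missing pairs
shows that \<open>A\<close> contains three quarters of all vertices. Fewer than \<open>v\<close> vertices of \<open>A\<close> exclude
fewer than \<open>|A|\<close> vertices from being a common neighbour, so around any two vertices of \<open>A\<close> a clique of
common neighbours of the required size can be built greedily inside \<open>A\<close>.
\<close>

lemma infected_clique_of_few_missing:
  assumes n: "4 * card V \<le> n"
    and few: "real (card {e \<in> pairs_of {1..n}. e \<notin> spread_set n Y}) < (real n)\<^sup>2 / (32 * real (card V))"
  shows "\<exists>A\<subseteq>{1..n}. 3 * real n / 4 \<le> real (card A) \<and> pairs_of A \<subseteq> spread_set n Y"
proof -
  let ?v = "real (card V)"
  define N where "N z = {z' \<in> {1..n}. z' \<noteq> z \<and> {z, z'} \<notin> spread_set n Y}" for z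
  define Bad where "Bad = {e \<in> pairs_of {1..n}. e \<notin> spread_set n Y}"
  define A where "A = {z \<in> {1..n}. real (card (N z)) \<le> real n / (4 * ?v)}"
  have v4: "4 \<le> ?v" using cardV by simp
  have n0: "0 < real n" using n cardV by simp
  have finN: "finite (N z)" for z by (simp add: N_def)
  have finBad: "finite Bad" unfolding Bad_def using finite_pairs_of[of "{1..n}"] by simp
  \<comment> \<open>Each missing pair is counted at its two ends.\<close>
  have "(\<Sum>z\<in>{1..n}. card (N z)) = card (SIGMA z:{1..n}. N z)"
    using finN by (simp add: card_SigmaI)
  also have "\<dots> = card ((\<lambda>(z, z'). ({z, z'}, z)) ` (SIGMA z:{1..n}. N z))"
    by (rule card_image[symmetric]) (auto simp: inj_on_def doubleton_eq_iff)
  also have "\<dots> \<le> card (SIGMA e:Bad. e)"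
  proof (rule card_mono)
    show "finite (SIGMA e:Bad. e)"
      using finBad by (intro finite_SigmaI) (auto simp: Bad_def pairs_of_def intro: finite_subset)
    show "(\<lambda>(z, z'). ({z, z'}, z)) ` (SIGMA z:{1..n}. N z) \<subseteq> (SIGMA e:Bad. e)"
      by (auto simp: N_def Bad_def doubleton_in_pairs_of)
  qed
  also have "\<dots> = (\<Sum>e\<in>Bad. card e)"
    using finBad by (intro card_SigmaI) (auto simp: Bad_def pairs_of_def intro: finite_subset)
  also have "\<dots> = (\<Sum>e\<in>Bad. 2)" by (rule sum.cong) (auto simp: Bad_def pairs_of_def)
  finally have "(\<Sum>z\<in>{1..n}. card (N z)) \<le> 2 * card Bad" by simp
  then have "real (\<Sum>z\<in>{1..n}. card (N z)) \<le> real (2 * card Bad)" by (rule of_nat_mono)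
  then have degsum: "(\<Sum>z\<in>{1..n}. real (card (N z))) \<le> 2 * real (card Bad)"
    by (simp only: of_nat_sum of_nat_mult of_nat_numeral)
  have finA: "finite A" by (simp add: A_def)
  have An: "A \<subseteq> {1..n}" by (auto simp: A_def)
  have "real (card ({1..n} - A)) * (real n / (4 * ?v)) = (\<Sum>z\<in>{1..n} - A. real n / (4 * ?v))" by simp
  also have "\<dots> \<le> (\<Sum>z\<in>{1..n} - A. real (card (N z)))"
    by (rule sum_mono) (auto simp: A_def)
  also have "\<dots> \<le> (\<Sum>z\<in>{1..n}. real (card (N z)))" by (rule sum_mono2) auto
  also have "\<dots> \<le> 2 * ((real n)\<^sup>2 / (32 * ?v))" using degsum few unfolding Bad_def by linarith
  also have "\<dots> = (real n / 4) * (real n / (4 * ?v))" by (simp add: power2_eq_square)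
  finally have "real (card ({1..n} - A)) \<le> real n / 4"
    by (rule mult_right_le_imp_le) (use n0 v4 in simp)
  moreover have "real (card ({1..n} - A)) = real n - real (card A)"
  proof -
    have "card ({1..n} - A) = n - card A" using An finA by (simp add: card_Diff_subset)
    moreover have "card A \<le> n" using card_mono[OF _ An] by simp
    ultimately show ?thesis by (simp add: of_nat_diff)
  qed
  ultimately have cardA: "3 * real n / 4 \<le> real (card A)" by linarith
  have clique: "{x, y} \<in> spread_set n Y" if xy: "x \<in> A" "y \<in> A" "x \<noteq> y" for x y
  proof -
    have "j \<le> card U \<Longrightarrow> \<exists>D\<subseteq>A - {x, y}. card D = j \<and>
        (\<forall>z\<in>D. \<forall>z'\<in>D \<union> {x, y}. z \<noteq> z' \<longrightarrow> {z, z'} \<in> spread_set n Y)" for j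
    proof (induction j)
      case 0
      show ?case by (rule exI[of _ "{}"]) simp
    next
      case (Suc j)
      then obtain D where D: "D \<subseteq> A - {x, y}" "card D = j"
        and adj: "\<forall>z\<in>D. \<forall>z'\<in>D \<union> {x, y}. z \<noteq> z' \<longrightarrow> {z, z'} \<in> spread_set n Y" by auto
      let ?T = "D \<union> {x, y}"
      have finD: "finite D" using D(1) finA finite_subset by blast
      have TA: "?T \<subseteq> A" using D(1) xy by auto
      have finT: "finite ?T" using finD by simp
      have "card ?T \<le> card D + card {x, y}" by (rule card_Un_le)
      then have cT: "card ?T \<le> j + 2" using D(2) xy by simp
      then have cT': "real (card ?T) \<le> ?v - 1" using Suc.prems cardU cardV by linarith
      have "card (?T \<union> (\<Union>z\<in>?T. N z)) \<le> card ?T + (\<Sum>z\<in>?T. card (N z))"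
        using card_Un_le[of ?T "\<Union>z\<in>?T. N z"] card_UN_le[OF finT, of N] by linarith
      then have "real (card (?T \<union> (\<Union>z\<in>?T. N z))) \<le> real (card ?T) + (\<Sum>z\<in>?T. real (card (N z)))"
        by (simp only: of_nat_sum[symmetric] of_nat_add[symmetric] of_nat_le_iff)
      also have "\<dots> \<le> real (card ?T) + (\<Sum>z\<in>?T. real n / (4 * ?v))"
        using TA by (intro add_left_mono sum_mono) (auto simp: A_def)
      also have "\<dots> = real (card ?T) * (1 + real n / (4 * ?v))" by (simp add: algebra_simps)
      also have "\<dots> \<le> (?v - 1) * (1 + real n / (4 * ?v))"
        using cT' n0 v4 by (intro mult_right_mono) auto
      also have "\<dots> < ?v * (1 + real n / (4 * ?v))"
        using n0 v4 by (intro mult_strict_right_mono) (auto intro: add_pos_pos)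
      also have "\<dots> = ?v + real n / 4" using v4 by (simp add: field_simps)
      also have "\<dots> \<le> 3 * real n / 4"
      proof -
        have "4 * ?v \<le> real n" using of_nat_mono[OF n, where 'a = real] by simp
        then show ?thesis using n0 by linarith
      qed
      also have "\<dots> \<le> real (card A)" by (rule cardA)
      finally have lt: "card (?T \<union> (\<Union>z\<in>?T. N z)) < card A" by simp
      have "\<not> A \<subseteq> ?T \<union> (\<Union>z\<in>?T. N z)"
      proof
        assume sub: "A \<subseteq> ?T \<union> (\<Union>z\<in>?T. N z)"
        have "finite (?T \<union> (\<Union>z\<in>?T. N z))" using finT finN by blast
        from card_mono[OF this sub] lt show False by simp
      qed
      then obtain w where w: "w \<in> A" "w \<notin> ?T" "\<And>z. z \<in> ?T \<Longrightarrow> w \<notin> N z" by blast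
      have wadj: "{w, z} \<in> spread_set n Y" if "z \<in> ?T" for z
      proof -
        have "z \<noteq> w" using that w(2) by blast
        then have "{z, w} \<in> spread_set n Y" using w(3)[OF that] w(1) An unfolding N_def by blast
        then show ?thesis by (simp add: insert_commute)
      qed
      show ?case
      proof (intro exI[of _ "insert w D"] conjI ballI impI)
        show "insert w D \<subseteq> A - {x, y}" using D(1) w by auto
        show "card (insert w D) = Suc j" using D(2) w(2) finD by simp
        fix z z' assume z: "z \<in> insert w D" "z' \<in> insert w D \<union> {x, y}" "z \<noteq> z'"
        show "{z, z'} \<in> spread_set n Y"
        proof (cases "z = w")
          case True
          then show ?thesis using wadj[of z'] z by blast
        next
          case False
          then have zD: "z \<in> D" using z(1) by simp
          show ?thesis
          proof (cases "z' = w")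
            case True
            then show ?thesis using wadj[of z] zD by (simp add: insert_commute)
          next
            case False
            then show ?thesis using adj zD z by blast
          qed
        qed
      qed
    qed
    from this[OF order_refl] obtain D where D: "D \<subseteq> A - {x, y}" "card D = card U"
      and adj: "\<forall>z\<in>D. \<forall>z'\<in>D \<union> {x, y}. z \<noteq> z' \<longrightarrow> {z, z'} \<in> spread_set n Y" by blast
    show ?thesis
    proof (rule infected_of_common_clique[where D = D])
      show "x \<in> {1..n}" "y \<in> {1..n}" using xy An by auto
      show "D \<subseteq> {1..n} - {x, y}" using D(1) An by blast
      fix z assume z: "z \<in> D"
      then have "z \<noteq> x" "z \<noteq> y" using D(1) by auto
      then show "{x, z} \<in> spread_set n Y \<and> {y, z} \<in> spread_set n Y"
        using adj z by (metis UnI2 insertCI insert_commute)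
    qed (use xy D adj in auto)
  qed
  have "pairs_of A \<subseteq> spread_set n Y"
  proof
    fix e assume e: "e \<in> pairs_of A"
    then obtain x y where "e = {x, y}" "x \<noteq> y" by (auto simp: pairs_of_def card_2_iff)
    then show "e \<in> spread_set n Y" using e clique by (auto simp: doubleton_in_pairs_of)
  qed
  then show ?thesis using An cardA by blast
qed

text \<open>
A vertex outside \<open>A\<close> with enough neighbours in \<open>A\<close> is joined to every \<open>u \<in> A\<close>, since its remaining neighbours
form a clique that is joined to \<open>u\<close> as well. After that \<open>A\<close> itself is a clique joined to any
two outside vertices.
\<close>

lemma infected_all_of_clique:
  assumes A: "A \<subseteq> {1..n}" "card V \<le> card A" "pairs_of A \<subseteq> spread_set n Y"
    and nbrs: "\<And>w. w \<in> {1..n} - A \<Longrightarrow> card V \<le> card {z \<in> A. {w, z} \<in> Y}"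
  shows "pairs_of {1..n} \<subseteq> spread_set n Y"
proof -
  have finA: "finite A" using A(1) by (rule finite_subset) simp
  have inA: "{z, z'} \<in> spread_set n Y" if "z \<in> A" "z' \<in> A" "z \<noteq> z'" for z z'
    using A(3) that by (auto simp: doubleton_in_pairs_of)
  have toA: "{w, u} \<in> spread_set n Y" if w: "w \<in> {1..n}" "u \<in> A" "w \<noteq> u" for w u
  proof (cases "w \<in> A")
    case False
    let ?N = "{z \<in> A. {w, z} \<in> Y}"
    show ?thesis
    proof (rule infected_of_common_clique[where D = "?N - {u}"])
      show "?N - {u} \<subseteq> {1..n} - {w, u}" using A(1) False by auto
      have "card V \<le> card ?N" using nbrs w False by simp
      moreover have "card ?N - card {u} \<le> card (?N - {u})" by (rule diff_card_le_card_Diff) simp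
      ultimately show "card U \<le> card (?N - {u})" using cardU cardV by simp
      fix z assume z: "z \<in> ?N - {u}"
      then show "{w, z} \<in> spread_set n Y \<and> {u, z} \<in> spread_set n Y"
        using inA[of u z] w(2) by (auto intro: infected.seed)
    qed (use w A(1) inA in auto)
  qed (use w inA in auto)
  show ?thesis
  proof
    fix e assume e: "e \<in> pairs_of {1..n}"
    then obtain x y where "e = {x, y}" "x \<noteq> y" by (auto simp: pairs_of_def card_2_iff)
    with e have xy: "x \<in> {1..n}" "y \<in> {1..n}" "x \<noteq> y" "e = {x, y}" by (auto simp: pairs_of_def)
    show "e \<in> spread_set n Y"
    proof (cases "x \<in> A \<or> y \<in> A")
      case True
      then show ?thesis using toA[of x y] toA[of y x] xy by (auto simp: insert_commute)
    next
      case False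
      have "{x, y} \<in> spread_set n Y"
      proof (rule infected_of_common_clique[where D = A])
        show "A \<subseteq> {1..n} - {x, y}" using A(1) False by auto
        show "card U \<le> card A" using A(2) cardU by simp
        show "{x, z} \<in> spread_set n Y \<and> {y, z} \<in> spread_set n Y" if "z \<in> A" for z
          using toA[of x z] toA[of y z] that xy False by auto
      qed (use xy inA in auto)
      then show ?thesis using xy by simp
    qed
  qed
qed

end

lemma prob_no_edge_to_block:
  fixes n :: nat
  assumes q: "0 \<le> q" "q \<le> 1" and w: "w \<in> {1..n}" and B: "B \<subseteq> {1..n} - {w}"
  shows "measure_pmf.prob (Pi_pmf (pairs_of {1..n}) False
      (\<lambda>e. if e \<in> Y then return_pmf True else bernoulli_pmf q)) {X. \<forall>z\<in>B. \<not> X {w, z}} \<le> (1 - q) ^ card B"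
proof -
  let ?P = "pairs_of {1..n}" and ?F = "(\<lambda>z. {w, z}) ` B"
  let ?M = "\<lambda>e. if e \<in> Y then return_pmf True else bernoulli_pmf q"
  have fin: "finite ?P" by (simp add: finite_pairs_of)
  have FP: "?F \<subseteq> ?P" using B w by (auto simp: doubleton_in_pairs_of)
  have "{X. \<forall>z\<in>B. \<not> X {w, z}} = Pi ?P (\<lambda>e. if e \<in> ?F then {False} else UNIV)"
    using FP by (auto simp: Pi_def)
  then have "measure_pmf.prob (Pi_pmf ?P False ?M) {X. \<forall>z\<in>B. \<not> X {w, z}}
      = (\<Prod>e\<in>?P. measure_pmf.prob (?M e) (if e \<in> ?F then {False} else UNIV))"
    by (simp only: measure_Pi_pmf_Pi[OF fin])
  also have "\<dots> \<le> (\<Prod>e\<in>?P. if e \<in> ?F then 1 - q else 1)"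
    by (rule prod_mono) (use q in \<open>auto simp: measure_pmf_single\<close>)
  also have "\<dots> = (1 - q) ^ card ?F"
    using FP fin by (subst prod.inter_restrict[symmetric]) (simp_all add: Int_absorb1)
  also have "card ?F = card B"
    by (rule card_image) (auto simp: inj_on_def doubleton_eq_iff)
  finally show ?thesis .
qed

text \<open>
Cut \<open>A\<close> into \<open>k\<close> disjoint blocks of size \<open>s\<close>. If a vertex has a neighbour in every block, it has \<open>k\<close> neighbours.
A union bound over all vertices and blocks then only involves the probability that one block is missed, a
single product of independent factors.
\<close>

lemma prob_many_neighbours:
  assumes q: "0 \<le> q" "q \<le> 1" and A: "A \<subseteq> {1..n}" "k * s \<le> card A" and Y: "Y \<subseteq> pairs_of {1..n}"
  shows "measure_pmf.prob (Pi_pmf (pairs_of {1..n}) False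
      (\<lambda>e. if e \<in> Y then return_pmf True else bernoulli_pmf q))
      {X. Y \<subseteq> {e \<in> pairs_of {1..n}. X e} \<and>
        (\<forall>w\<in>{1..n} - A. k \<le> card {z \<in> A. {w, z} \<in> {e \<in> pairs_of {1..n}. X e}})}
    \<ge> 1 - real (n * k) * (1 - q) ^ s"
proof -
  let ?P = "pairs_of {1..n}"
  let ?M = "Pi_pmf ?P False (\<lambda>e. if e \<in> Y then return_pmf True else bernoulli_pmf q)"
  have fin: "finite ?P" by (simp add: finite_pairs_of)
  have finA: "finite A" using A(1) by (rule finite_subset) simp
  obtain h where h: "bij_betw h {0..<card A} A" using ex_bij_betw_nat_finite[OF finA] by blast
  define blk where "blk j = h ` {j * s..<j * s + s}" for j
  have range: "{j * s..<j * s + s} \<subseteq> {0..<card A}" if "j < k" for j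
  proof -
    have "Suc j * s \<le> k * s" using that by (intro mult_le_mono1) simp
    then show ?thesis using A(2) by auto
  qed
  have blkA: "blk j \<subseteq> A" if "j < k" for j
    using range[OF that] h unfolding blk_def bij_betw_def by blast
  have cblk: "card (blk j) = s" if "j < k" for j
  proof -
    have "inj_on h {j * s..<j * s + s}"
      using range[OF that] h unfolding bij_betw_def by (meson inj_on_subset)
    then show ?thesis unfolding blk_def by (simp add: card_image)
  qed
  have blk_disj: "blk i \<inter> blk j = {}" if ij: "i < k" "j < k" "i < j" for i j
  proof -
    have "Suc i * s \<le> j * s" using ij by (intro mult_le_mono1) simp
    then have "{i * s..<i * s + s} \<inter> {j * s..<j * s + s} = {}" by auto
    then show ?thesis
      using inj_on_image_Int[of h "{0..<card A}" "{i * s..<i * s + s}" "{j * s..<j * s + s}"] range ij h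
      unfolding blk_def bij_betw_def by auto
  qed
  define Miss where "Miss wj = {X :: nat set \<Rightarrow> bool. \<forall>z\<in>blk (snd wj). \<not> X {fst wj, z}}" for wj
  define J where "J = ({1..n} - A) \<times> {..<k}"
  have finJ: "finite J" by (simp add: J_def)
  have "measure_pmf.prob ?M (\<Union>wj\<in>J. Miss wj) \<le> (\<Sum>wj\<in>J. measure_pmf.prob ?M (Miss wj))"
    by (rule measure_pmf.finite_measure_subadditive_finite[OF finJ]) simp
  also have "\<dots> \<le> (\<Sum>wj\<in>J. (1 - q) ^ s)"
  proof (rule sum_mono)
    fix wj assume "wj \<in> J"
    then obtain w j where wj: "wj = (w, j)" "w \<in> {1..n}" "w \<notin> A" "j < k" by (auto simp: J_def)
    have "blk j \<subseteq> {1..n} - {w}" using blkA[OF wj(4)] A(1) wj(3) by blast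
    from prob_no_edge_to_block[OF q wj(2) this, of Y] cblk[OF wj(4)]
    show "measure_pmf.prob ?M (Miss wj) \<le> (1 - q) ^ s" by (simp add: Miss_def wj(1))
  qed
  also have "\<dots> = real (card J) * (1 - q) ^ s" by simp
  also have "\<dots> \<le> real (n * k) * (1 - q) ^ s"
  proof (rule mult_right_mono)
    have "card ({1..n} - A) \<le> card {1..n}" by (rule card_mono) auto
    then have "card J \<le> n * k" unfolding J_def by (simp add: card_cartesian_product)
    then show "real (card J) \<le> real (n * k)" by (rule of_nat_mono)
  qed (use q in simp)
  finally have miss: "measure_pmf.prob ?M (\<Union>wj\<in>J. Miss wj) \<le> real (n * k) * (1 - q) ^ s" .
  have "1 - real (n * k) * (1 - q) ^ s \<le> measure_pmf.prob ?M (- (\<Union>wj\<in>J. Miss wj))"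
    using miss measure_pmf.prob_compl[of "\<Union>wj\<in>J. Miss wj" ?M] by (simp add: Compl_eq_Diff_UNIV)
  also have "\<dots> \<le> measure_pmf.prob ?M {X. Y \<subseteq> {e \<in> ?P. X e} \<and>
        (\<forall>w\<in>{1..n} - A. k \<le> card {z \<in> A. {w, z} \<in> {e \<in> ?P. X e}})}"
  proof -
    let ?T = "{X. Y \<subseteq> {e \<in> ?P. X e} \<and> (\<forall>w\<in>{1..n} - A. k \<le> card {z \<in> A. {w, z} \<in> {e \<in> ?P. X e}})}"
    have "- (\<Union>wj\<in>J. Miss wj) \<inter> set_pmf ?M \<subseteq> ?T"
    proof
      fix X assume X: "X \<in> - (\<Union>wj\<in>J. Miss wj) \<inter> set_pmf ?M"
      then have "X \<in> set_pmf ?M" by simp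
      then have supp: "X \<in> PiE_dflt ?P False (set_pmf \<circ> (\<lambda>e. if e \<in> Y then return_pmf True else bernoulli_pmf q))"
        by (rule subsetD[OF set_Pi_pmf_subset'[OF fin]])
      have "X e" if "e \<in> Y" for e
      proof -
        have "X e \<in> (set_pmf \<circ> (\<lambda>e. if e \<in> Y then return_pmf True else bernoulli_pmf q)) e"
          using supp that Y unfolding PiE_dflt_def by blast
        then show ?thesis using that by simp
      qed
      then have YX: "Y \<subseteq> {e \<in> ?P. X e}" using Y by auto
      have "k \<le> card {z \<in> A. {w, z} \<in> {e \<in> ?P. X e}}" if w: "w \<in> {1..n} - A" for w
      proof -
        have "\<exists>z\<in>blk j. X {w, z}" if "j < k" for j
        proof (rule ccontr)
          assume "\<not> ?thesis"
          then have "X \<in> Miss (w, j)" by (simp add: Miss_def)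
          moreover have "(w, j) \<in> J" using w that by (simp add: J_def)
          ultimately show False using X by blast
        qed
        then obtain f where f: "\<And>j. j < k \<Longrightarrow> f j \<in> blk j \<and> X {w, f j}" by metis
        have inj: "inj_on f {..<k}"
        proof (rule inj_onI)
          fix i j assume ij: "i \<in> {..<k}" "j \<in> {..<k}" "f i = f j"
          show "i = j"
          proof (rule ccontr)
            assume "i \<noteq> j"
            then have "blk i \<inter> blk j = {}" using blk_disj[of i j] blk_disj[of j i] ij by (cases "i < j") auto
            then show False using f[of i] f[of j] ij by auto
          qed
        qed
        have "f ` {..<k} \<subseteq> {z \<in> A. {w, z} \<in> {e \<in> ?P. X e}}"
        proof
          fix z assume "z \<in> f ` {..<k}"
          then obtain j where j: "j < k" "z = f j" by auto
          then have z: "z \<in> A" "X {w, z}" using f[OF j(1)] blkA[OF j(1)] by auto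
          moreover have "{w, z} \<in> ?P" using z w A(1) by (auto simp: doubleton_in_pairs_of)
          ultimately show "z \<in> {z \<in> A. {w, z} \<in> {e \<in> ?P. X e}}" by simp
        qed
        then have "card {..<k} \<le> card {z \<in> A. {w, z} \<in> {e \<in> ?P. X e}}"
          using finA by (intro card_inj_on_le[OF inj]) auto
        then show ?thesis by simp
      qed
      then show "X \<in> ?T" using YX by blast
    qed
    then have "measure_pmf.prob ?M (- (\<Union>wj\<in>J. Miss wj) \<inter> set_pmf ?M) \<le> measure_pmf.prob ?M ?T"
      by (rule measure_pmf.finite_measure_mono) simp
    then show ?thesis by (simp only: measure_Int_set_pmf)
  qed
  finally show ?thesis .
qed

section \<open>The threshold\<close>

lemma stretched_exponential_decay:
  fixes \<sigma> c :: real
  assumes "0 < \<sigma>" "0 < c"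
  shows "(\<lambda>n. real n * exp (1 - c * real n powr \<sigma>)) \<longlonglongrightarrow> 0"
  using assms by real_asymp

context balanced_rung begin

text \<open>
The first round succeeds with probability at least \<open>3/4\<close> and the second one, given the first, with
probability at least \<open>2/3\<close>; the product is \<open>1/2\<close>. The failure probability \<open>1 / (128 v)\<close> of a single pair
is what Markov's inequality needs for the number \<open>n\<^sup>2 / (32 v)\<close> of missing pairs that
\<open>infected_clique_of_few_missing\<close> tolerates.
\<close>

lemma prob_percolates_ge_half:
  assumes p: "0 < p" "p \<le> 1" and n: "4 * card V \<le> n"
    and pair: "\<And>x y. x \<in> {1..n} \<Longrightarrow> y \<in> {1..n} \<Longrightarrow> x \<noteq> y \<Longrightarrow>
      measure_pmf.prob (random_edges n p) {Y. {x, y} \<in> spread_set n Y} \<ge> 1 - 1 / (128 * real (card V))"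
    and sprinkle: "real (n * card V) * (1 - p) ^ (n div (2 * card V)) \<le> 1 / 3"
  shows "measure_pmf.prob (gnp n (p + p - p * p)) {G. perc_closure \<lparr>verts = V, edges = E\<rparr> G = complete_graph n} \<ge> 1 / 2"
proof -
  let ?v = "real (card V)" and ?H = "\<lparr>verts = V, edges = E\<rparr>" and ?P = "pairs_of {1..n}"
  define t where "t = (real n)\<^sup>2 / (32 * ?v)"
  define Good where "Good = {Y. real (card {e \<in> ?P. e \<notin> spread_set n Y}) < t}"
  define S where "S = {Y. perc_closure ?H \<lparr>verts = {1..n}, edges = Y\<rparr> = complete_graph n}"
  have v0: "0 < ?v" using cardV by simp
  have n0: "0 < real n" and n2: "2 \<le> n" using n cardV by auto
  have t0: "0 < t" using n0 v0 by (simp add: t_def)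
  have H: "finite_simple_graph ?H" using finV EV by (simp add: finite_simple_graph_def)
  have "measure_pmf.prob (random_edges n p) {Y. real (card {e \<in> ?P. Y \<notin> {Y. e \<in> spread_set n Y}}) < t}
      \<ge> 1 - 1 / (128 * ?v) * real (card ?P) / t"
  proof (rule prob_many_failures)
    show "finite ?P" by (simp add: finite_pairs_of)
    fix e assume e: "e \<in> ?P"
    then obtain x y where "e = {x, y}" "x \<noteq> y" by (auto simp: pairs_of_def card_2_iff)
    with e show "1 - 1 / (128 * ?v) \<le> measure_pmf.prob (random_edges n p) {Y. e \<in> spread_set n Y}"
      using pair[of x y] by (simp add: doubleton_in_pairs_of)
  qed (rule t0)
  then have good: "measure_pmf.prob (random_edges n p) Good \<ge> 1 - 1 / (128 * ?v) * real (card ?P) / t"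
    by (simp add: Good_def)
  have "card ?P \<le> n ^ 2"
    using n_subsets[of "{1..n}" 2] binomial_le_pow[OF n2] by (simp add: pairs_of_def)
  then have "real (card ?P) \<le> real (n ^ 2)" by (rule of_nat_mono)
  then have "real (card ?P) \<le> (real n)\<^sup>2" by simp
  then have "1 / (128 * ?v) * real (card ?P) / t \<le> 1 / (128 * ?v) * (real n)\<^sup>2 / t"
    using v0 t0 by (intro divide_right_mono mult_left_mono) auto
  also have "\<dots> = 1 / 4" using v0 n0 by (simp add: t_def field_simps)
  finally have good': "3 / 4 \<le> measure_pmf.prob (random_edges n p) Good" using good by linarith
  have "measure_pmf.prob (random_edges n (p + p - p * p)) S \<ge> 3 / 4 * (2 / 3)"
  proof (rule random_edges_sprinkle[OF _ p(2) _ p(2) _ good'])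
    fix Y assume Y: "Y \<in> Good" "Y \<subseteq> ?P"
    obtain A where A: "A \<subseteq> {1..n}" "3 * real n / 4 \<le> real (card A)" "pairs_of A \<subseteq> spread_set n Y"
      using infected_clique_of_few_missing[OF n] Y(1) unfolding Good_def t_def by blast
    have half: "card V * (n div (2 * card V)) \<le> card A"
    proof -
      have "2 * (card V * (n div (2 * card V))) = 2 * card V * (n div (2 * card V))" by simp
      also have "\<dots> \<le> n" by (rule times_div_less_eq_dividend)
      finally have "real (2 * (card V * (n div (2 * card V)))) \<le> real n" by (rule of_nat_mono)
      then have "2 * real (card V * (n div (2 * card V))) \<le> real n"
        by (simp only: of_nat_mult of_nat_numeral)
      then have "real (card V * (n div (2 * card V))) \<le> real (card A)" using A(2) n0 by linarith
      then show ?thesis by (simp only: of_nat_le_iff)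
    qed
    have vA: "card V \<le> card A"
    proof -
      have "4 * ?v \<le> real n" using of_nat_mono[OF n, where 'a = real] by simp
      then have "?v \<le> real (card A)" using A(2) v0 by linarith
      then show ?thesis by simp
    qed
    let ?M = "Pi_pmf ?P False (\<lambda>e. if e \<in> Y then return_pmf True else bernoulli_pmf p)"
    have "2 / 3 \<le> 1 - real (n * card V) * (1 - p) ^ (n div (2 * card V))" using sprinkle by linarith
    also have "\<dots> \<le> measure_pmf.prob ?M {X. Y \<subseteq> {e \<in> ?P. X e} \<and>
        (\<forall>w\<in>{1..n} - A. card V \<le> card {z \<in> A. {w, z} \<in> {e \<in> ?P. X e}})}"
      by (rule prob_many_neighbours[OF less_imp_le[OF p(1)] p(2) A(1) half Y(2)])
    also have "\<dots> \<le> measure_pmf.prob ?M {X. {e \<in> ?P. X e} \<in> S}"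
    proof (rule measure_pmf.finite_measure_mono)
      show "{X. Y \<subseteq> {e \<in> ?P. X e} \<and> (\<forall>w\<in>{1..n} - A. card V \<le> card {z \<in> A. {w, z} \<in> {e \<in> ?P. X e}})}
          \<subseteq> {X. {e \<in> ?P. X e} \<in> S}"
      proof (intro subsetI CollectI, elim CollectE conjE)
        fix X assume YX: "Y \<subseteq> {e \<in> ?P. X e}"
          and nb: "\<forall>w\<in>{1..n} - A. card V \<le> card {z \<in> A. {w, z} \<in> {e \<in> ?P. X e}}"
        have "pairs_of A \<subseteq> spread_set n {e \<in> ?P. X e}" using A(3) infected_mono[OF YX] by (rule order_trans)
        then have "?P \<subseteq> spread_set n {e \<in> ?P. X e}"
          by (rule infected_all_of_clique[OF A(1) vA]) (rule bspec[OF nb])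
        then show "{e \<in> ?P. X e} \<in> S"
          unfolding S_def by (intro CollectI perc_closure_eq_complete_graph[OF H]) auto
      qed
    qed simp
    finally show "2 / 3 \<le> measure_pmf.prob ?M {X. {e \<in> ?P. X e} \<in> S}" .
  qed (use p in auto)
  then show ?thesis by (simp add: gnp_eq_random_edges measure_map_pmf vimage_def S_def)
qed

text \<open>
Two rounds of density \<open>p\<close> have union density at most \<open>2 p\<close>. A block of the second round has linear size, so
it is missed with probability exponentially small in \<open>n p\<close>, a positive power of \<open>n\<close>.
\<close>

lemma crit_threshold_bound:
  "\<exists>C. \<forall>\<^sub>F n in sequentially. crit_threshold n \<lparr>verts = V, edges = E\<rparr> \<le> C * real n powr (- 1 / lm)"
proof -
  let ?v = "real (card V)" and ?H = "\<lparr>verts = V, edges = E\<rparr>"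
  have v4: "4 \<le> ?v" using cardV by simp
  have eps: "0 < 1 / (128 * ?v)" using v4 by simp
  obtain C where C: "1 \<le> C" and ev: "\<forall>\<^sub>F n in sequentially. C * real n powr (- 1 / lm) \<le> 1 \<and>
    (\<forall>x\<in>{1..n}. \<forall>y\<in>{1..n}. x \<noteq> y \<longrightarrow>
      measure_pmf.prob (random_edges n (C * real n powr (- 1 / lm))) {Y. {x, y} \<in> spread_set n Y} \<ge> 1 - 1 / (128 * ?v))"
    using eventually_prob_infected[OF eps] by blast
  define \<sigma> where "\<sigma> = 1 - 1 / lm"
  have \<sigma>: "0 < \<sigma>" using lm1 by (simp add: \<sigma>_def)
  have "(\<lambda>n. ?v * (real n * exp (1 - 1 / (2 * ?v) * real n powr \<sigma>))) \<longlonglongrightarrow> ?v * 0"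
    using v4 \<sigma> by (intro tendsto_mult tendsto_const stretched_exponential_decay) auto
  then have small: "\<forall>\<^sub>F n in sequentially. ?v * (real n * exp (1 - 1 / (2 * ?v) * real n powr \<sigma>)) < 1 / 3"
    by (rule order_tendstoD(2)) simp
  have "\<forall>\<^sub>F n in sequentially. crit_threshold n ?H \<le> (2 * C) * real n powr (- 1 / lm)"
    using ev small eventually_ge_at_top[of "4 * card V"]
  proof eventually_elim
    case (elim n)
    define p where "p = C * real n powr (- 1 / lm)"
    have n0: "0 < real n" using elim(3) cardV by simp
    have p: "0 < p" "p \<le> 1" using C n0 elim(1) by (auto simp: p_def)
    have pair: "measure_pmf.prob (random_edges n p) {Y. {x, y} \<in> spread_set n Y} \<ge> 1 - 1 / (128 * ?v)"
      if "x \<in> {1..n}" "y \<in> {1..n}" "x \<noteq> y" for x y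
      using elim(1) that unfolding p_def by blast
    define s where "s = n div (2 * card V)"
    have "n < (s + 1) * (2 * card V)"
      unfolding s_def using div_less_iff_less_mult[of "2 * card V" n "n div (2 * card V) + 1"] cardV by simp
    then have "real n < real ((s + 1) * (2 * card V))" by (simp only: of_nat_less_iff)
    then have "real n < (real s + 1) * (2 * ?v)"
      by (simp only: of_nat_mult of_nat_add of_nat_1 of_nat_numeral)
    then have "real n / (2 * ?v) < real s + 1" using v4 by (simp add: pos_divide_less_eq)
    then have "p * (real n / (2 * ?v) - 1) \<le> p * real s" using p by (intro mult_left_mono) auto
    moreover have "p * (real n / (2 * ?v) - 1) = p * real n / (2 * ?v) - p" by (simp add: algebra_simps)
    moreover have "real n powr \<sigma> \<le> p * real n"
    proof -
      have "real n powr \<sigma> = real n powr (- 1 / lm + 1)" by (simp add: \<sigma>_def)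
      also have "\<dots> = real n powr (- 1 / lm) * real n" using n0 by (simp only: powr_add powr_one)
      also have "\<dots> \<le> p * real n" using mult_right_mono[OF C, of "real n powr (- 1 / lm)"] n0
        unfolding p_def by (intro mult_right_mono) auto
      finally show ?thesis .
    qed
    then have "1 / (2 * ?v) * real n powr \<sigma> \<le> p * real n / (2 * ?v)" using v4 by (simp add: divide_right_mono)
    ultimately have ps: "- (p * real s) \<le> 1 - 1 / (2 * ?v) * real n powr \<sigma>" using p by linarith
    have "(1 - p) ^ s \<le> exp (- p) ^ s"
      using p exp_ge_add_one_self[of "- p"] by (intro power_mono) auto
    also have "\<dots> = exp (- (p * real s))" by (simp add: exp_of_nat_mult[symmetric] mult.commute)
    also have "\<dots> \<le> exp (1 - 1 / (2 * ?v) * real n powr \<sigma>)" using ps by simp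
    finally have "real (n * card V) * (1 - p) ^ s \<le> real (n * card V) * exp (1 - 1 / (2 * ?v) * real n powr \<sigma>)"
      by (rule mult_left_mono) simp
    also have "\<dots> = ?v * (real n * exp (1 - 1 / (2 * ?v) * real n powr \<sigma>))" by simp
    also have "\<dots> \<le> 1 / 3" using elim(2) by (rule less_imp_le)
    finally have sprinkle: "real (n * card V) * (1 - p) ^ (n div (2 * card V)) \<le> 1 / 3" unfolding s_def .
    have half: "1 / 2 \<le> measure_pmf.prob (gnp n (p + p - p * p)) {G. perc_closure ?H G = complete_graph n}"
      by (rule prob_percolates_ge_half[OF p elim(3) pair sprinkle])
    have "0 \<le> (1 - p) * (1 - p)" by simp
    then have le1: "p + p - p * p \<le> 1" by (simp add: algebra_simps)
    have "p * p \<le> p * 1" using p by (intro mult_left_mono) auto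
    then have pos: "0 < p + p - p * p" using p by linarith
    have "crit_threshold n ?H \<le> p + p - p * p"
      unfolding crit_threshold_def
    proof (rule cInf_lower)
      show "bdd_below {p. 0 < p \<and> p \<le> 1 \<and> 1 / 2 \<le> measure_pmf.prob (gnp n p) {G. perc_closure ?H G = complete_graph n}}"
        by (rule bdd_belowI[of _ 0]) auto
    qed (use half le1 pos in simp)
    also have "\<dots> \<le> 2 * p" using p by simp
    finally show ?case by (simp add: p_def)
  qed
  then show ?thesis by blast
qed

end

theorem theorem6:
  fixes H :: "'a sgraph"
  assumes "finite_simple_graph H"
    and "num_verts H \<ge> 4"
    and "strictly_balanced H"
    and "min_degree H \<ge> 2"
  shows "\<exists>C::real. \<forall>\<^sub>F n in sequentially. crit_threshold n H \<le> C * real n powr (- 1 / lam H)"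
proof -
  obtain a b c d where "balanced_rung (verts H) (edges H) a b c d (lam H)"
    using balanced_rung_exists[OF assms] .
  then interpret balanced_rung "verts H" "edges H" a b c d "lam H" .
  have H_eq: "\<lparr>verts = verts H, edges = edges H\<rparr> = H" by (cases H) simp
  show ?thesis using crit_threshold_bound unfolding H_eq .
qed

end
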